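(* Let $k\ge 1$ and let a cyclic snake $kC_{14}$ with string $(d_1,d_2,\dots,d_{k-2})$ be given such that, for all $1\le i\le k-2$, $d_i\in\{6,7\}$ if $i$ is odd and $d_i=7$ if $i$ is even. Then this $kC_{14}$ is graceful if $k$ is even and near graceful if $k$ is odd.
   Context: For a graph $G=(V,E)$ with $m$ edges, a map $f:V\to\{0,1,\dots,m\}$ is a graceful labelling if $f$ is injective and the induced edge labelling $g(uv)=|f(u)-f(v)|$ is a bijection from $E$ onto $\{1,2,\dots,m\}$; $G$ is graceful if it has a graceful labelling. A map $f:V\to\{0,1,\dots,m+1\}$ is a near graceful labelling if $f$ is injective and the induced edge labelling $g(uv)=|f(u)-f(v)|$ is a bijection from $E$ onto $A$, where $A$ is $\{1,2,\dots,m-1,m\}$ or $\{1,2,\dots,m-1,m+1\}$; $G$ is near graceful if it has a near graceful labelling. Convention: all near graceful labellings asserted to exist omit both the vertex label $m$ and the edge label $m$, i.e. $f$ takes values in $\{0,1,\dots,m-1,m+1\}$ and $A=\{1,2,\dots,m-1,m+1\}$. $kC_r$ denotes any connected graph with exactly $k$ blocks, each block a cycle $C_r$ of length $r$, whose block-cutpoint graph is a path (so the blocks can be listed $B_1,\dots,B_k$ with $B_i$ and $B_{i+1}$ sharing exactly one vertex, which is the $i$-th cut vertex, and the $k-1$ cut vertices are distinct). For $k\ge 3$ its string is $(d_1,\dots,d_{k-2})$, where $d_i$ is the distance between the $i$-th and $(i+1)$-th cut vertices counted from one end of the snake to the other; for $k\in\{1,2\}$ there is no string and conditions on the string are vacuous.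 *)

theory Defs
  imports Main
begin

section \<open>Finite simple graphs\<close>

record 'a ugraph =
  verts :: "'a set"
  edges :: "'a set set"

definition simple_graph :: "'a ugraph \<Rightarrow> bool" where
  "simple_graph G \<longleftrightarrow> finite (verts G) \<and> (\<forall>e\<in>edges G. e \<subseteq> verts G \<and> card e = 2)"

definition subgraph :: "'a ugraph \<Rightarrow> 'a ugraph \<Rightarrow> bool" where
  "subgraph H G \<longleftrightarrow> simple_graph H \<and> verts H \<subseteq> verts G \<and> edges H \<subseteq> edges G"

definition adj :: "'a ugraph \<Rightarrow> ('a \<times> 'a) set" where
  "adj G = {(u, v). {u, v} \<in> edges G}"

definition graph_connected :: "'a ugraph \<Rightarrow> bool" where
  "graph_connected G \<longleftrightarrow> verts G \<noteq> {} \<and> (\<forall>u\<in>verts G. \<forall>v\<in>verts G. (u, v) \<in> (adj G)\<^sup>*)"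

text \<open>Length of a shortest walk; only meaningful when the two vertices are connected in the graph.\<close>

definition graph_dist :: "'a ugraph \<Rightarrow> 'a \<Rightarrow> 'a \<Rightarrow> nat" where
  "graph_dist G u v = (LEAST n. (u, v) \<in> adj G ^^ n)"

definition del_vertex :: "'a ugraph \<Rightarrow> 'a \<Rightarrow> 'a ugraph" where
  "del_vertex G v = \<lparr>verts = verts G - {v}, edges = {e \<in> edges G. v \<notin> e}\<rparr>"

text \<open>The list enumerates the vertices of a path graph along the path. The one-vertex path is allowed.\<close>

definition path_order :: "'a list \<Rightarrow> 'a ugraph \<Rightarrow> bool" where
  "path_order xs G \<longleftrightarrow> xs \<noteq> [] \<and> distinct xs \<and> verts G = set xs \<and>
     edges G = {{xs ! i, xs ! Suc i} | i. Suc i < length xs}"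

definition path_graph :: "'a ugraph \<Rightarrow> bool" where
  "path_graph G \<longleftrightarrow> (\<exists>xs. path_order xs G)"

definition cycle_graph :: "nat \<Rightarrow> 'a ugraph \<Rightarrow> bool" where
  "cycle_graph r G \<longleftrightarrow> r \<ge> 3 \<and> (\<exists>xs. length xs = r \<and> distinct xs \<and> verts G = set xs \<and>
     edges G = {{xs ! i, xs ! (Suc i mod r)} | i. i < r})"

section \<open>Blocks and the block-cutpoint graph\<close>

text \<open>A cut vertex separates two other vertices of its component.\<close>

definition cut_vertex :: "'a ugraph \<Rightarrow> 'a \<Rightarrow> bool" where
  "cut_vertex G v \<longleftrightarrow> v \<in> verts G \<and>
     (\<exists>u\<in>verts G - {v}. \<exists>w\<in>verts G - {v}.
        (u, w) \<in> (adj G)\<^sup>* \<and> (u, w) \<notin> (adj (del_vertex G v))\<^sup>*)"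

text \<open>Blocks are maximal among the connected subgraphs \<open>H\<close> that have no cut vertex of \<open>H\<close> itself
  (a block may of course contain cut vertices of \<open>G\<close>).\<close>

definition nonseparable_subgraph :: "'a ugraph \<Rightarrow> 'a ugraph \<Rightarrow> bool" where
  "nonseparable_subgraph H G \<longleftrightarrow>
     subgraph H G \<and> graph_connected H \<and> (\<forall>v. \<not> cut_vertex H v)"

definition blocks :: "'a ugraph \<Rightarrow> 'a ugraph set" where
  "blocks G = {B. nonseparable_subgraph B G \<and>
     (\<forall>H. nonseparable_subgraph H G \<and> subgraph B H \<longrightarrow> H = B)}"

definition block_cutpoint_graph :: "'a ugraph \<Rightarrow> ('a ugraph + 'a) ugraph" where
  "block_cutpoint_graph G =
     \<lparr>verts = Inl ` blocks G \<union> Inr ` {v. cut_vertex G v},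
      edges = {{Inl B, Inr v} | B v. B \<in> blocks G \<and> cut_vertex G v \<and> v \<in> verts B}\<rparr>"

section \<open>Cyclic snakes\<close>

definition cyclic_snake :: "nat \<Rightarrow> nat \<Rightarrow> 'a ugraph \<Rightarrow> bool" where
  "cyclic_snake k r G \<longleftrightarrow> simple_graph G \<and> graph_connected G \<and>
     card (blocks G) = k \<and> (\<forall>B\<in>blocks G. cycle_graph r B) \<and>
     path_graph (block_cutpoint_graph G)"

text \<open>Traversing the block-cutpoint path from one of its two ends to the other lists the cut vertices
  in order; the string records the distances between consecutive ones. A snake thus has a string for
  each direction of traversal (each the reverse of the other). With at most one cut vertex, the
  string is empty.\<close>

definition snake_string :: "'a ugraph \<Rightarrow> nat list \<Rightarrow> bool" where
  "snake_string G ds \<longleftrightarrow> (\<exists>ps cs. path_order ps (block_cutpoint_graph G) \<and>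
     cs = map projr (filter (\<lambda>x. \<not> isl x) ps) \<and>
     ds = map (\<lambda>i. graph_dist G (cs ! i) (cs ! Suc i)) [0..<length cs - 1])"

section \<open>Graceful and near graceful labellings\<close>

definition edge_label :: "('a \<Rightarrow> nat) \<Rightarrow> 'a set \<Rightarrow> nat" where
  "edge_label f e = Max (f ` e) - Min (f ` e)"

lemma edge_label_pair: "int (edge_label f {u, v}) = \<bar>int (f u) - int (f v)\<bar>"
  by (auto simp: edge_label_def max_def min_def)

definition graceful_labelling :: "'a ugraph \<Rightarrow> ('a \<Rightarrow> nat) \<Rightarrow> bool" where
  "graceful_labelling G f \<longleftrightarrow> (let m = card (edges G) in
     f ` verts G \<subseteq> {0..m} \<and> inj_on f (verts G) \<and>
     bij_betw (edge_label f) (edges G) {1..m})"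

definition graceful :: "'a ugraph \<Rightarrow> bool" where
  "graceful G \<longleftrightarrow> (\<exists>f. graceful_labelling G f)"

definition near_graceful_labelling :: "'a ugraph \<Rightarrow> ('a \<Rightarrow> nat) \<Rightarrow> bool" where
  "near_graceful_labelling G f \<longleftrightarrow> (let m = card (edges G) in
     f ` verts G \<subseteq> {0..m + 1} \<and> inj_on f (verts G) \<and>
     (bij_betw (edge_label f) (edges G) {1..m} \<or>
      bij_betw (edge_label f) (edges G) ({1..<m} \<union> {m + 1})))"

text \<open>Convention: near graceful labellings asserted to exist omit both the vertex label \<open>m\<close> and the
  edge label \<open>m\<close>, where \<open>m\<close> is the number of edges.\<close>

definition near_graceful_omitting :: "'a ugraph \<Rightarrow> bool" where
  "near_graceful_omitting G \<longleftrightarrow> (\<exists>f. near_graceful_labelling G f \<and> (let m = card (edges G) in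
     f ` verts G \<subseteq> {0..<m} \<union> {m + 1} \<and>
     bij_betw (edge_label f) (edges G) ({1..<m} \<union> {m + 1})))"

end

theory Submission
  imports Defs
begin

text \<open>
  Labelling a snake. Suppose the first \<open>2q\<close> cycles carry a graceful labelling with \<open>m = 28q\<close> edges in
  which the vertex shared with the next cycle has label \<open>0\<close>. Take a labelling \<open>g\<close> of the next one or
  two cycles that is split by a threshold \<open>s\<close>: every edge joins a \<^emph>\<open>low\<close> label \<open>\<le> s\<close> to a \<^emph>\<open>high\<close>
  label \<open>> s\<close>, and the attaching vertex has the label \<open>s\<close> itself. Shift the old labels by \<open>s\<close> and the
  high new labels by \<open>m\<close>: the old labels now fill the gap that has opened between the low and the
  high ones, the two labellings agree at the attaching vertex, old edge labels are unchanged and every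
  new edge label grows by exactly \<open>m\<close> (\<open>glue_around\<close>). So edge labels \<open>1,\<dots>,m\<close> are extended
  consecutively, and everything is reduced to finding suitable \<open>g\<close>.

  The sum of the edge labels around a cycle is even, so the edges of one \<open>C\<^sub>1\<^sub>4\<close> cannot be labelled
  \<open>1,\<dots>,14\<close>; but \<open>1,\<dots>,13,15\<close> is possible, which finishes an odd snake, and a second cycle can take
  the labels \<open>14,16,\<dots>,28\<close>. Hence the cycles are added in pairs. In the pair
  (\<open>two_cycles_labelling\<close>) the two cycles meet at a vertex opposite to the attaching vertex of the
  first, and in the second cycle the vertices at distance \<open>6\<close> and \<open>7\<close> from the common vertex have
  the largest label \<open>28\<close> and the smallest label \<open>0\<close>. This is where the condition on the string comes
  from. Whichever of the two the next cycle is attached to, the labelling or its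
  complement \<open>m - f\<close> gives that vertex the label \<open>0\<close>, and the induction goes on
  (\<open>even_prefix_labelling\<close>).

  Before this, the definition of a snake by blocks has to be turned into coordinates: vertex \<open>j\<close> of
  cycle \<open>i\<close>, with consecutive cycles glued at known positions and no other coincidences
  (\<open>snake_layout_exists\<close>). Three facts carry it. A cut vertex lies in two blocks, so the
  block-cutpoint path begins and ends with a block and alternates between blocks and cut vertices. A
  closed chain of blocks would be nonseparable, contradicting maximality, so blocks meet only where
  the path says (\<open>blocks_closed_chain\<close>). Finally, collapsing the two sides of a snake onto the cut vertices
  of one cycle does not lengthen walks, so the entries of the string are distances within single
  cycles.
\<close>

section \<open>Blocks\<close>

lemma adj_rtrancl_mono:
  assumes "edges H \<subseteq> edges H'" and "(u, v) \<in> (adj H)\<^sup>*"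
  shows "(u, v) \<in> (adj H')\<^sup>*"
proof -
  have "adj H \<subseteq> adj H'" using assms(1) by (auto simp: adj_def)
  then show ?thesis using assms(2) rtrancl_mono by blast
qed

text \<open>The set \<open>X\<close> may be smaller than the vertex set of \<open>H\<close>, and walks may leave \<open>X\<close>; this allows linked
  sets to be merged inside one fixed graph.\<close>

definition linked_in :: "'a ugraph \<Rightarrow> 'a set \<Rightarrow> bool" where
  "linked_in H X \<longleftrightarrow> (\<forall>u\<in>X. \<forall>w\<in>X. (u, w) \<in> (adj H)\<^sup>*)"

lemma linked_in_Un:
  assumes "linked_in H X" "linked_in H Y" "z \<in> X" "z \<in> Y"
  shows "linked_in H (X \<union> Y)"
  unfolding linked_in_def
proof (intro ballI)
  fix u w assume "u \<in> X \<union> Y" "w \<in> X \<union> Y"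
  then have "(u, z) \<in> (adj H)\<^sup>*" "(z, w) \<in> (adj H)\<^sup>*"
    using assms by (auto simp: linked_in_def)
  then show "(u, w) \<in> (adj H)\<^sup>*" by (rule rtrancl_trans)
qed

lemma linked_in_mono:
  assumes "linked_in H X" "edges H \<subseteq> edges H'"
  shows "linked_in H' X"
  using assms(1) adj_rtrancl_mono[OF assms(2)] by (auto simp: linked_in_def)

lemma linked_in_chain:
  fixes X :: "nat \<Rightarrow> 'a set"
  assumes "i \<le> j"
    and "\<And>l. i \<le> l \<Longrightarrow> l \<le> j \<Longrightarrow> linked_in H (X l)"
    and "\<And>l. i \<le> l \<Longrightarrow> l < j \<Longrightarrow> c l \<in> X l \<and> c l \<in> X (Suc l)"
  shows "linked_in H (\<Union>l\<in>{i..j}. X l)"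
  using assms
proof (induction j rule: dec_induct)
  case base
  then show ?case by simp
next
  case (step n)
  have "linked_in H ((\<Union>l\<in>{i..n}. X l) \<union> X (Suc n))"
  proof (rule linked_in_Un)
    show "linked_in H (\<Union>l\<in>{i..n}. X l)" using step by simp
    show "linked_in H (X (Suc n))" using step by simp
    show "c n \<in> (\<Union>l\<in>{i..n}. X l)" using step.hyps step.prems(2)[of n] by auto
    show "c n \<in> X (Suc n)" using step.hyps step.prems(2)[of n] by auto
  qed
  moreover have "{i..Suc n} = insert (Suc n) {i..n}" using step.hyps by auto
  ultimately show ?case by (simp add: Un_commute)
qed

lemma del_vertex_notin:
  assumes "simple_graph H" "x \<notin> verts H"
  shows "edges (del_vertex H x) = edges H"
  using assms by (auto simp: del_vertex_def simple_graph_def)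

lemma edges_del_vertex: "edges (del_vertex H x) = {e \<in> edges H. x \<notin> e}"
  by (simp add: del_vertex_def)

text \<open>Nonseparable means: linked, and still linked after the loss of any one vertex. In this form the
  property can be checked for a union of blocks by merging linked sets.\<close>

lemma nonseparable_subgraph_iff:
  "nonseparable_subgraph H G \<longleftrightarrow>
     subgraph H G \<and> verts H \<noteq> {} \<and> linked_in H (verts H) \<and>
     (\<forall>x. linked_in (del_vertex H x) (verts H - {x}))"
proof
  assume L: "nonseparable_subgraph H G"
  then have sg: "subgraph H G" and ne: "verts H \<noteq> {}" and con: "linked_in H (verts H)"
    and ncut: "\<And>v. \<not> cut_vertex H v"
    by (auto simp: nonseparable_subgraph_def graph_connected_def linked_in_def)
  have "linked_in (del_vertex H x) (verts H - {x})" for x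
  proof (cases "x \<in> verts H")
    case True
    then show ?thesis
      using ncut[of x] con unfolding cut_vertex_def linked_in_def by blast
  next
    case False
    then have "edges (del_vertex H x) = edges H"
      using sg del_vertex_notin[of H x] by (simp add: subgraph_def)
    then show ?thesis using con False linked_in_mono by fastforce
  qed
  then show "subgraph H G \<and> verts H \<noteq> {} \<and> linked_in H (verts H) \<and>
     (\<forall>x. linked_in (del_vertex H x) (verts H - {x}))" using sg ne con by blast
next
  assume "subgraph H G \<and> verts H \<noteq> {} \<and> linked_in H (verts H) \<and>
     (\<forall>x. linked_in (del_vertex H x) (verts H - {x}))"
  then show "nonseparable_subgraph H G"
    unfolding nonseparable_subgraph_def graph_connected_def cut_vertex_def linked_in_def
    by blast
qed

text \<open>A finite graph has a largest nonseparable subgraph above \<open>H\<close>, measured by the number of vertices and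
  edges. Single vertices and single edges are nonseparable, so the blocks cover the graph.\<close>

lemma nonseparable_in_block:
  assumes "simple_graph G" "nonseparable_subgraph H G"
  obtains B where "B \<in> blocks G" "subgraph H B"
proof -
  define P where "P B \<longleftrightarrow> nonseparable_subgraph B G \<and> subgraph H B" for B
  define sz where "sz B = card (verts B) + card (edges B)" for B :: "'a ugraph"
  have finE: "finite (edges G)"
    using assms(1) by (auto simp: simple_graph_def intro!: finite_subset[of "edges G" "Pow (verts G)"])
  have finV: "finite (verts G)" using assms(1) by (simp add: simple_graph_def)
  have PH: "P H" using assms(2) by (auto simp: P_def nonseparable_subgraph_def subgraph_def)
  have bound: "sz B \<le> sz G" if "subgraph B G" for B
    unfolding sz_def using that finE finV by (auto simp: subgraph_def intro!: add_mono card_mono)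
  have "\<forall>B. P B \<longrightarrow> sz B < Suc (sz G)"
    using bound by (auto simp: P_def nonseparable_subgraph_def less_Suc_eq_le)
  then obtain B where PB: "P B" and mx: "\<And>C. P C \<Longrightarrow> sz C \<le> sz B"
    using ex_has_greatest_nat[of P H sz "Suc (sz G)"] PH by blast
  have "C = B" if C: "nonseparable_subgraph C G" "subgraph B C" for C
  proof -
    have sub: "verts B \<subseteq> verts C" "edges B \<subseteq> edges C" using C by (auto simp: subgraph_def)
    have fin: "finite (verts C)" "finite (edges C)"
      using C(1) finV finE by (auto simp: nonseparable_subgraph_def subgraph_def intro: finite_subset)
    have "P C" using PB C unfolding P_def subgraph_def by blast
    then have "sz C \<le> sz B" by (rule mx)
    moreover have "card (verts B) \<le> card (verts C)" "card (edges B) \<le> card (edges C)"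
      using sub fin by (auto intro: card_mono)
    ultimately have "card (verts B) = card (verts C)" "card (edges B) = card (edges C)"
      by (auto simp: sz_def)
    then have "verts B = verts C" "edges B = edges C"
      using sub fin by (auto simp: card_subset_eq)
    then show ?thesis by simp
  qed
  then have "B \<in> blocks G" using PB by (auto simp: blocks_def P_def)
  then show ?thesis using that PB by (auto simp: P_def)
qed

lemma vertex_in_block:
  assumes "simple_graph G" "v \<in> verts G"
  obtains B where "B \<in> blocks G" "v \<in> verts B"
proof -
  have "nonseparable_subgraph \<lparr>verts = {v}, edges = {}\<rparr> G"
    using assms by (auto simp: nonseparable_subgraph_iff linked_in_def subgraph_def simple_graph_def)
  then obtain B where "B \<in> blocks G" "subgraph \<lparr>verts = {v}, edges = {}\<rparr> B"
    using nonseparable_in_block assms(1) by blast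
  then show ?thesis using that by (auto simp: subgraph_def)
qed

lemma edge_in_block:
  assumes "simple_graph G" "e \<in> edges G"
  obtains B where "B \<in> blocks G" "e \<in> edges B"
proof -
  let ?H = "\<lparr>verts = e, edges = {e}\<rparr>"
  have e: "e \<subseteq> verts G" "card e = 2" using assms by (auto simp: simple_graph_def)
  then obtain u v where uv: "e = {u, v}" "u \<noteq> v" by (auto simp: card_2_iff)
  have "(u, v) \<in> adj ?H" "(v, u) \<in> adj ?H" by (auto simp: adj_def uv(1) insert_commute)
  then have "linked_in ?H e" by (auto simp: linked_in_def uv(1))
  moreover have "linked_in (del_vertex ?H x) (e - {x})" for x
  proof (cases "x \<in> e")
    case True
    then show ?thesis using uv by (auto simp: linked_in_def)
  next
    case False
    then have "edges (del_vertex ?H x) = edges ?H" by (auto simp: del_vertex_def)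
    then show ?thesis using False \<open>linked_in ?H e\<close> linked_in_mono by fastforce
  qed
  moreover have "subgraph ?H G"
    using e assms uv by (auto simp: subgraph_def simple_graph_def)
  ultimately have "nonseparable_subgraph ?H G"
    using uv by (auto simp: nonseparable_subgraph_iff)
  then obtain B where "B \<in> blocks G" "subgraph ?H B"
    using nonseparable_in_block assms(1) by blast
  then show ?thesis using that by (auto simp: subgraph_def)
qed

text \<open>If \<open>v\<close> were in one block only, all its neighbours would lie in that block and be linked there
  without \<open>v\<close>. So every walk through \<open>v\<close> could be rerouted, and \<open>v\<close> would not be a cut vertex.\<close>

lemma cut_vertex_in_two_blocks:
  assumes "simple_graph G" "cut_vertex G v"
  obtains B C where "B \<in> blocks G" "C \<in> blocks G" "B \<noteq> C" "v \<in> verts B" "v \<in> verts C"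
proof (rule ccontr)
  note two_blocks = that
  assume no: "\<not> thesis"
  have uniq: "B = C"
    if "B \<in> blocks G" "C \<in> blocks G" "v \<in> verts B" "v \<in> verts C" for B C
    using two_blocks no that by blast
  obtain u w where uw: "u \<in> verts G - {v}" "w \<in> verts G - {v}" "(u, w) \<in> (adj G)\<^sup>*"
    "(u, w) \<notin> (adj (del_vertex G v))\<^sup>*"
    using assms(2) by (auto simp: cut_vertex_def)
  have nb: "(y, z) \<in> (adj (del_vertex G v))\<^sup>*" if yz: "{y, v} \<in> edges G" "{v, z} \<in> edges G" for y z
  proof -
    obtain B where B: "B \<in> blocks G" "{y, v} \<in> edges B" using edge_in_block assms(1) yz(1) by blast
    obtain C where C: "C \<in> blocks G" "{v, z} \<in> edges C" using edge_in_block assms(1) yz(2) by blast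
    have ns: "nonseparable_subgraph B G" "nonseparable_subgraph C G"
      using B C by (auto simp: blocks_def)
    then have sB: "simple_graph B" "simple_graph C" "edges B \<subseteq> edges G"
      by (auto simp: nonseparable_subgraph_def subgraph_def)
    have mem: "y \<in> verts B" "v \<in> verts B" "v \<in> verts C" "z \<in> verts C"
      using sB B C by (auto simp: simple_graph_def)
    have ne: "y \<noteq> v" "z \<noteq> v" using sB B C by (force simp: simple_graph_def)+
    have "C = B" using uniq B C mem by blast
    then have "(y, z) \<in> (adj (del_vertex B v))\<^sup>*"
      using ns(1) mem ne by (auto simp: nonseparable_subgraph_iff linked_in_def)
    moreover have "edges (del_vertex B v) \<subseteq> edges (del_vertex G v)"
      using sB(3) by (auto simp: edges_del_vertex)
    ultimately show ?thesis by (rule adj_rtrancl_mono[rotated])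
  qed
  \<comment> \<open>A walk that has just reached \<open>v\<close> is recorded by a neighbour of \<open>v\<close> reachable without \<open>v\<close>.\<close>
  have "(y \<noteq> v \<longrightarrow> (u, y) \<in> (adj (del_vertex G v))\<^sup>*) \<and>
    (y = v \<longrightarrow> (\<exists>z. {z, v} \<in> edges G \<and> (u, z) \<in> (adj (del_vertex G v))\<^sup>*))"
    if "(u, y) \<in> (adj G)\<^sup>*" for y
    using that
  proof (induction rule: rtrancl_induct)
    case base
    then show ?case using uw(1) by auto
  next
    case (step y z)
    have e: "{y, z} \<in> edges G" using step.hyps(2) by (auto simp: adj_def)
    then have "y \<noteq> z" using assms(1) by (force simp: simple_graph_def)
    consider "y = v" "z \<noteq> v" | "y \<noteq> v" "z = v" | "y \<noteq> v" "z \<noteq> v" using \<open>y \<noteq> z\<close> by blast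
    then show ?case
    proof cases
      case 1
      then obtain z' where "{z', v} \<in> edges G" "(u, z') \<in> (adj (del_vertex G v))\<^sup>*"
        using step.IH by blast
      then have "(u, z) \<in> (adj (del_vertex G v))\<^sup>*"
        using nb[of z' z] e 1 by (auto intro: rtrancl_trans)
      then show ?thesis using 1 by blast
    next
      case 2
      then show ?thesis using step.IH e by blast
    next
      case 3
      then have "(y, z) \<in> adj (del_vertex G v)" using e by (auto simp: adj_def edges_del_vertex)
      then show ?thesis using 3 step.IH by (auto intro: rtrancl.rtrancl_into_rtrancl)
    qed
  qed
  then show False using uw by blast
qed

text \<open>A chain of blocks through distinct vertices \<open>c\<close> whose ends meet again in a further vertex \<open>v\<close> is
  a ring. Deleting a vertex breaks the ring in at most one place, so the union of the chain is
  nonseparable, and by maximality equals each of its blocks. For \<open>j = i + 1\<close> this says that two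
  blocks share at most one vertex.\<close>

lemma blocks_closed_chain:
  fixes B :: "nat \<Rightarrow> 'a ugraph" and c :: "nat \<Rightarrow> 'a"
  assumes "i < j"
    and blk: "\<And>l. i \<le> l \<Longrightarrow> l \<le> j \<Longrightarrow> B l \<in> blocks G"
    and c: "\<And>l. i \<le> l \<Longrightarrow> l < j \<Longrightarrow> c l \<in> verts (B l) \<and> c l \<in> verts (B (Suc l))"
    and inj: "inj_on c {i..<j}"
    and v: "v \<in> verts (B i)" "v \<in> verts (B j)" "v \<notin> c ` {i..<j}"
  shows "B i = B j"
proof -
  define U where "U = \<lparr>verts = (\<Union>l\<in>{i..j}. verts (B l)), edges = (\<Union>l\<in>{i..j}. edges (B l))\<rparr>"
  have ns: "nonseparable_subgraph (B l) G" if "i \<le> l" "l \<le> j" for l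
    using blk[OF that] by (auto simp: blocks_def)
  have sub: "subgraph (B l) G" "verts (B l) \<noteq> {}" "linked_in (B l) (verts (B l))"
    "linked_in (del_vertex (B l) x) (verts (B l) - {x})" if "i \<le> l" "l \<le> j" for l x
    using ns[OF that] unfolding nonseparable_subgraph_iff by auto
  have UG: "subgraph U G"
    using sub(1) unfolding U_def subgraph_def simple_graph_def
    by (fastforce intro!: finite_UN_I)
  have BU: "subgraph (B l) U" if "i \<le> l" "l \<le> j" for l
    using sub(1)[OF that] that unfolding U_def subgraph_def by auto
  have "linked_in U (\<Union>l\<in>{i..j}. verts (B l))"
  proof (rule linked_in_chain)
    show "linked_in U (verts (B l))" if "i \<le> l" "l \<le> j" for l
      using sub(3)[OF that] BU[OF that] linked_in_mono by (auto simp: subgraph_def)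
  qed (use \<open>i < j\<close> c in auto)
  then have con: "linked_in U (verts U)" by (simp add: U_def)
  have del: "linked_in (del_vertex U x) (verts U - {x})" for x
  proof -
    let ?X = "\<lambda>l. verts (B l) - {x}"
    have X: "linked_in (del_vertex U x) (?X l)" if "i \<le> l" "l \<le> j" for l
      using sub(4)[OF that, of x] BU[OF that]
      by (rule_tac linked_in_mono) (auto simp: subgraph_def edges_del_vertex)
    have VU: "verts U - {x} = (\<Union>l\<in>{i..j}. ?X l)" by (auto simp: U_def)
    show ?thesis
    proof (cases "x \<in> c ` {i..<j}")
      case False
      have "linked_in (del_vertex U x) (\<Union>l\<in>{i..j}. ?X l)"
      proof (rule linked_in_chain)
        show "c l \<in> ?X l \<and> c l \<in> ?X (Suc l)" if "i \<le> l" "l < j" for l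
          using c[OF that] False that by auto
      qed (use \<open>i < j\<close> X in auto)
      then show ?thesis by (simp only: VU)
    next
      case True
      \<comment> \<open>The chain falls into two parts, which are still joined through \<open>v\<close>.\<close>
      then obtain m where m: "i \<le> m" "m < j" "x = c m" by auto
      have ne: "c l \<noteq> x" if "i \<le> l" "l < j" "l \<noteq> m" for l
        using inj that m by (auto simp: inj_on_def)
      have "linked_in (del_vertex U x) (\<Union>l\<in>{i..m}. ?X l)"
      proof (rule linked_in_chain)
        show "c l \<in> ?X l \<and> c l \<in> ?X (Suc l)" if "i \<le> l" "l < m" for l
          using c[of l] ne[of l] that m by auto
      qed (use m X in auto)
      moreover have "linked_in (del_vertex U x) (\<Union>l\<in>{Suc m..j}. ?X l)"
      proof (rule linked_in_chain)
        show "c l \<in> ?X l \<and> c l \<in> ?X (Suc l)" if "Suc m \<le> l" "l < j" for l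
          using c[of l] ne[of l] that m by auto
      qed (use m X in auto)
      moreover have "v \<noteq> x" using v(3) m by auto
      then have "v \<in> (\<Union>l\<in>{i..m}. ?X l)" "v \<in> (\<Union>l\<in>{Suc m..j}. ?X l)"
        using v m by force+
      ultimately have "linked_in (del_vertex U x) ((\<Union>l\<in>{i..m}. ?X l) \<union> (\<Union>l\<in>{Suc m..j}. ?X l))"
        by (rule linked_in_Un)
      moreover have "{i..j} = {i..m} \<union> {Suc m..j}" using m by auto
      ultimately show ?thesis by (simp only: VU UN_Un)
    qed
  qed
  have "verts U \<noteq> {}" using v(1) \<open>i < j\<close> by (auto simp: U_def)
  then have "nonseparable_subgraph U G"
    unfolding nonseparable_subgraph_iff using UG con del by blast
  then have "U = B i" "U = B j"
    using blk[of i] blk[of j] BU[of i] BU[of j] \<open>i < j\<close> by (auto simp: blocks_def)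
  then show ?thesis by simp
qed

section \<open>Enumerated cycles\<close>

definition cycle_edges :: "nat \<Rightarrow> (nat \<Rightarrow> 'a) \<Rightarrow> 'a set set" where
  "cycle_edges r h = (\<lambda>j. {h j, h (Suc j mod r)}) ` {..<r}"

definition enumerates_cycle :: "nat \<Rightarrow> (nat \<Rightarrow> 'a) \<Rightarrow> 'a ugraph \<Rightarrow> bool" where
  "enumerates_cycle r h B \<longleftrightarrow>
     inj_on h {..<r} \<and> verts B = h ` {..<r} \<and> edges B = cycle_edges r h"

lemma cycle_graph_enumerates:
  assumes "cycle_graph r B"
  obtains h where "enumerates_cycle r h B"
proof -
  obtain xs where xs: "length xs = r" "distinct xs" "verts B = set xs"
    "edges B = {{xs ! i, xs ! (Suc i mod r)} | i. i < r}"
    using assms by (auto simp: cycle_graph_def)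
  have "enumerates_cycle r ((!) xs) B"
    unfolding enumerates_cycle_def cycle_edges_def
    using xs by (auto simp: inj_on_def nth_eq_iff_index_eq set_conv_nth image_def)
  then show ?thesis by (rule that)
qed

lemma enumerates_cycle_rotate:
  assumes h: "enumerates_cycle r h B" and "s < r"
  shows "enumerates_cycle r (\<lambda>j. h ((j + s) mod r)) B"
proof -
  let ?t = "\<lambda>j. (j + s) mod r"
  have "r > 0" using \<open>s < r\<close> by simp
  have inv: "?t ((j + (r - s)) mod r) = j" if "j < r" for j
    using that \<open>s < r\<close> by (simp add: mod_simps)
  have surj: "?t ` {..<r} = {..<r}"
  proof
    show "?t ` {..<r} \<subseteq> {..<r}" using \<open>r > 0\<close> by auto
    show "{..<r} \<subseteq> ?t ` {..<r}"
    proof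
      fix j assume "j \<in> {..<r}"
      then show "j \<in> ?t ` {..<r}"
        using inv[of j] \<open>r > 0\<close> by (intro image_eqI[of _ _ "(j + (r - s)) mod r"]) auto
    qed
  qed
  then have injt: "inj_on ?t {..<r}" by (intro eq_card_imp_inj_on) auto
  have "inj_on (h \<circ> ?t) {..<r}"
    using h injt surj by (intro comp_inj_on) (auto simp: enumerates_cycle_def)
  moreover have "h ` {..<r} = (h \<circ> ?t) ` {..<r}" by (simp only: image_comp[symmetric] surj)
  moreover have "cycle_edges r h = cycle_edges r (h \<circ> ?t)"
  proof -
    have "cycle_edges r h = (\<lambda>j. {h j, h (Suc j mod r)}) ` (?t ` {..<r})"
      by (simp only: surj cycle_edges_def)
    also have "\<dots> = cycle_edges r (h \<circ> ?t)"
      unfolding image_image cycle_edges_def by (simp add: mod_simps)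
    finally show ?thesis .
  qed
  ultimately show ?thesis using h by (simp add: enumerates_cycle_def comp_def)
qed

lemma enumerates_cycle_reverse:
  assumes h: "enumerates_cycle r h B"
  shows "enumerates_cycle r (\<lambda>j. h ((r - j) mod r)) B"
proof -
  let ?t = "\<lambda>j. (r - j) mod r"
  have surj: "?t ` {..<r} = {..<r}"
  proof
    show "?t ` {..<r} \<subseteq> {..<r}" by auto
    show "{..<r} \<subseteq> ?t ` {..<r}"
    proof
      fix j assume "j \<in> {..<r}"
      then show "j \<in> ?t ` {..<r}"
        by (intro image_eqI[of _ _ "(r - j) mod r"]) (cases "j = 0", auto)
    qed
  qed
  then have injt: "inj_on ?t {..<r}" by (intro eq_card_imp_inj_on) auto
  have "inj_on (h \<circ> ?t) {..<r}"
    using h injt surj by (intro comp_inj_on) (auto simp: enumerates_cycle_def)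
  moreover have "h ` {..<r} = (h \<circ> ?t) ` {..<r}" by (simp only: image_comp[symmetric] surj)
  moreover have "cycle_edges r h = cycle_edges r (h \<circ> ?t)"
  proof -
    have "(\<lambda>j. r - Suc j) ` {..<r} = {..<r}"
    proof
      show "{..<r} \<subseteq> (\<lambda>j. r - Suc j) ` {..<r}"
      proof
        fix j assume "j \<in> {..<r}"
        then show "j \<in> (\<lambda>j. r - Suc j) ` {..<r}"
          by (intro image_eqI[of _ _ "r - Suc j"]) auto
      qed
    qed auto
    then have "cycle_edges r h = (\<lambda>j. {h j, h (Suc j mod r)}) ` ((\<lambda>j. r - Suc j) ` {..<r})"
      by (simp only: cycle_edges_def)
    also have "\<dots> = cycle_edges r (h \<circ> ?t)"
      unfolding image_image cycle_edges_def
    proof (rule image_cong[OF refl])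
      fix j assume "j \<in> {..<r}"
      then have "Suc (r - Suc j) = r - j" by auto
      moreover have "(r - Suc j mod r) mod r = r - Suc j"
      proof (cases "Suc j = r")
        case True
        then show ?thesis by simp
      next
        case False
        then show ?thesis using \<open>j \<in> {..<r}\<close> by simp
      qed
      ultimately show "{h (r - Suc j), h (Suc (r - Suc j) mod r)} =
          {(h \<circ> ?t) j, (h \<circ> ?t) (Suc j mod r)}"
        by (auto simp: insert_commute)
    qed
    finally show ?thesis .
  qed
  ultimately show ?thesis using h by (simp add: enumerates_cycle_def comp_def)
qed

text \<open>Rotating puts \<open>a\<close> at position \<open>0\<close>; if \<open>b\<close> is then more than half way round, reversing the
  direction makes its position equal to its distance from \<open>a\<close>.\<close>

lemma enumerates_cycle_from_to:
  assumes "cycle_graph r B" "a \<in> verts B" "b \<in> verts B"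
  obtains h p where "enumerates_cycle r h B" "h 0 = a" "h p = b" "2 * p \<le> r" "p < r"
proof -
  have "r \<ge> 3" using assms(1) by (simp add: cycle_graph_def)
  obtain h0 where h0: "enumerates_cycle r h0 B" using assms(1) cycle_graph_enumerates by blast
  then obtain s where s: "s < r" "h0 s = a" using assms(2) by (auto simp: enumerates_cycle_def)
  define h where "h j = h0 ((j + s) mod r)" for j
  have h: "enumerates_cycle r h B"
    using enumerates_cycle_rotate[OF h0 s(1)] by (simp add: h_def[abs_def])
  have ha: "h 0 = a" using s by (simp add: h_def)
  obtain p where p: "p < r" "h p = b" using h assms(3) by (auto simp: enumerates_cycle_def)
  show ?thesis
  proof (cases "2 * p \<le> r")
    case True
    then show ?thesis using that h ha p by blast
  next
    case False
    have "enumerates_cycle r (\<lambda>j. h ((r - j) mod r)) B" by (rule enumerates_cycle_reverse[OF h])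
    moreover have "(r - (r - p)) mod r = p" using p by simp
    ultimately show ?thesis
      using that[of "\<lambda>j. h ((r - j) mod r)" "r - p"] False p ha \<open>r \<ge> 3\<close> by auto
  qed
qed

lemma enumerates_cycle_at:
  assumes "cycle_graph r B" "a \<in> verts B" "d < r"
  obtains h where "enumerates_cycle r h B" "h d = a"
proof -
  obtain h0 where h0: "enumerates_cycle r h0 B" "h0 0 = a"
    using enumerates_cycle_from_to assms(1,2) by metis
  have lt: "(r - d) mod r < r" using assms(3) by simp
  have "(d + (r - d) mod r) mod r = 0" using assms(3) by (simp add: mod_simps)
  then show ?thesis
    using that[OF enumerates_cycle_rotate[OF h0(1) lt]] h0(2) by simp
qed

section \<open>Distances\<close>

text \<open>A walk of length \<open>p\<close> is shortest if some potential, changing by at most one along each edge,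
  rises by \<open>p\<close> between its ends.\<close>

lemma graph_dist_eqI:
  fixes \<phi> :: "'a \<Rightarrow> nat"
  assumes walk: "(u, w) \<in> adj G ^^ p" and \<phi>: "\<phi> w = \<phi> u + p"
    and step: "\<And>x y. {x, y} \<in> edges G \<Longrightarrow> \<phi> y \<le> Suc (\<phi> x)"
  shows "graph_dist G u w = p"
  unfolding graph_dist_def
proof (rule Least_equality)
  show "(u, w) \<in> adj G ^^ p" by (rule walk)
  have "\<phi> y \<le> \<phi> u + n" if "(u, y) \<in> adj G ^^ n" for n y
    using that
  proof (induction n arbitrary: y)
    case (Suc n)
    then obtain x where x: "(u, x) \<in> adj G ^^ n" "{x, y} \<in> edges G" by (auto simp: adj_def)
    show ?case using Suc.IH[OF x(1)] step[OF x(2)] by simp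
  qed simp
  then show "p \<le> n" if "(u, w) \<in> adj G ^^ n" for n using that \<phi> by fastforce
qed

lemma cycle_walk:
  assumes "enumerates_cycle r h B" "edges B \<subseteq> edges G" "p < r"
  shows "(h 0, h p) \<in> adj G ^^ p"
  using assms(3)
proof (induction p)
  case (Suc p)
  then have "{h p, h (Suc p)} \<in> edges B"
    using assms(1) by (auto simp: enumerates_cycle_def cycle_edges_def intro!: image_eqI[of _ _ p])
  then have "(h p, h (Suc p)) \<in> adj G" using assms(2) by (auto simp: adj_def)
  then show ?case using Suc by auto
qed simp

text \<open>The potential used for a cycle is \<open>min j (r - j)\<close>, the distance of position \<open>j\<close> from position
  \<open>0\<close>.\<close>

lemma cycle_index_step:
  fixes r :: nat
  assumes "j < r"
  shows "min (Suc j mod r) (r - Suc j mod r) \<le> Suc (min j (r - j))"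
    and "min j (r - j) \<le> Suc (min (Suc j mod r) (r - Suc j mod r))"
proof -
  have "Suc j mod r = (if Suc j = r then 0 else Suc j)" using assms by auto
  then show "min (Suc j mod r) (r - Suc j mod r) \<le> Suc (min j (r - j))"
    "min j (r - j) \<le> Suc (min (Suc j mod r) (r - Suc j mod r))"
    using assms by auto
qed

section \<open>Coordinates on a snake\<close>

lemma filter_alternating:
  assumes "\<And>i. i < length ps \<Longrightarrow> P (ps ! i) \<longleftrightarrow> odd i"
  shows "filter P ps = map (\<lambda>i. ps ! (2 * i + 1)) [0..<length ps div 2]"
  using assms
proof (induction ps rule: induct_list012)
  case (3 x y zs)
  have "P (zs ! i) \<longleftrightarrow> odd i" if "i < length zs" for i
    using "3.prems"[of "Suc (Suc i)"] that by simp
  then have IH: "filter P zs = map (\<lambda>i. zs ! (2 * i + 1)) [0..<length zs div 2]"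
    using "3.IH"(1) by blast
  have xy: "\<not> P x" "P y" using "3.prems"[of 0] "3.prems"[of 1] by auto
  have "[0..<length (x # y # zs) div 2] = 0 # map Suc [0..<length zs div 2]"
    by (simp add: upt_conv_Cons map_Suc_upt del: upt_Suc)
  then show ?case using xy IH by (simp del: upt_Suc)
qed auto

text \<open>The block-cutpoint path alternates, since its edges join blocks to cut vertices, and both its
  ends are blocks, since an end has only one neighbour on the path while a cut vertex lies in two
  blocks. Hence the \<open>k\<close> blocks stand at the even positions and the \<open>k - 1\<close> cut vertices at the odd
  ones.\<close>

lemma snake_path:
  assumes snake: "cyclic_snake k r G" and path: "path_order ps (block_cutpoint_graph G)"
  obtains B c where "blocks G = B ` {..<k}" "inj_on B {..<k}"
    "inj_on c {..<k - 1}"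
    "\<And>i l. Suc i < k \<Longrightarrow> l < k \<Longrightarrow> c i \<in> verts (B l) \<longleftrightarrow> l = i \<or> l = Suc i"
    "map projr (filter (\<lambda>x. \<not> isl x) ps) = map c [0..<k - 1]"
proof -
  define n where "n = length ps"
  have G: "simple_graph G" and card: "card (blocks G) = k" using snake by (auto simp: cyclic_snake_def)
  have n0: "n > 0" and dist: "distinct ps" using path by (auto simp: path_order_def n_def)
  have V: "set ps = Inl ` blocks G \<union> Inr ` {v. cut_vertex G v}"
    and E: "{{Inl B, Inr v} | B v. B \<in> blocks G \<and> cut_vertex G v \<and> v \<in> verts B} =
      {{ps ! i, ps ! Suc i} | i. Suc i < n}"
    using path by (auto simp: path_order_def block_cutpoint_graph_def n_def)
  have nth_eq: "ps ! i = ps ! j \<longleftrightarrow> i = j" if "i < n" "j < n" for i j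
    using that dist by (simp add: n_def nth_eq_iff_index_eq)
  have incid: "\<exists>i. Suc i < n \<and> {Inl B, Inr v} = {ps ! i, ps ! Suc i}"
    if "B \<in> blocks G" "cut_vertex G v" "v \<in> verts B" for B v
  proof -
    have "{Inl B, Inr v} \<in> {{ps ! i, ps ! Suc i} | i. Suc i < n}" using that unfolding E[symmetric] by blast
    then show ?thesis by blast
  qed
  have alt: "isl (ps ! Suc i) \<longleftrightarrow> \<not> isl (ps ! i)" if "Suc i < n" for i
  proof -
    have "{ps ! i, ps ! Suc i} \<in> {{Inl B, Inr v} | B v. B \<in> blocks G \<and> cut_vertex G v \<and> v \<in> verts B}"
      using that unfolding E by blast
    then show ?thesis by (auto simp: doubleton_eq_iff)
  qed
  \<comment> \<open>The element at \<open>e\<close> is an end of the path: it occurs in the edge number \<open>i0\<close> only.\<close>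
  have end_block: "isl (ps ! e)"
    if e: "e < n" and nbr: "\<And>i. Suc i < n \<Longrightarrow> e = i \<or> e = Suc i \<Longrightarrow> i = i0" for e i0
  proof (rule ccontr)
    assume "\<not> isl (ps ! e)"
    then obtain v where v: "ps ! e = Inr v" by (cases "ps ! e") auto
    then have "Inr v \<in> set ps" using e by (metis n_def nth_mem)
    then have "cut_vertex G v" using V by auto
    then obtain B C where BC: "B \<in> blocks G" "C \<in> blocks G" "B \<noteq> C" "v \<in> verts B" "v \<in> verts C"
      by (rule cut_vertex_in_two_blocks[OF G]) blast
    have "{Inl X, ps ! e} = {ps ! i0, ps ! Suc i0}" if X: "X \<in> blocks G" "v \<in> verts X" for X
    proof -
      obtain i where i: "Suc i < n" "{Inl X, Inr v} = {ps ! i, ps ! Suc i}"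
        using incid[OF X(1) \<open>cut_vertex G v\<close> X(2)] by auto
      have "ps ! e = ps ! i \<or> ps ! e = ps ! Suc i" using i(2) v by (auto simp: doubleton_eq_iff)
      then have "e = i \<or> e = Suc i" using nth_eq e i(1) by auto
      then have "i = i0" using nbr i(1) by blast
      then show ?thesis using i(2) v by simp
    qed
    then have "{Inl B, Inr v} = {Inl C, Inr v}" using BC v by metis
    then show False using BC(3) by (auto simp: doubleton_eq_iff)
  qed
  have "isl (ps ! 0)" by (rule end_block[of 0 0]) (use n0 in auto)
  then have par: "isl (ps ! i) \<longleftrightarrow> even i" if "i < n" for i
    using that by (induction i) (auto simp: alt)
  have "isl (ps ! (n - 1))" by (rule end_block[of "n - 1" "n - 2"]) (use n0 in auto)
  then have "even (n - 1)" using par n0 by auto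
  then obtain m where m: "n = Suc (2 * m)" using n0 by (metis Suc_pred' evenE)
  define B where "B i = projl (ps ! (2 * i))" for i
  define c where "c i = projr (ps ! (2 * i + 1))" for i
  have B: "ps ! (2 * i) = Inl (B i)" if "i < Suc m" for i
    using par[of "2 * i"] that m by (simp add: B_def)
  have c: "ps ! (2 * i + 1) = Inr (c i)" if "i < m" for i
    using par[of "2 * i + 1"] that m by (simp add: c_def)
  have bl: "b \<in> blocks G \<longleftrightarrow> Inl b \<in> set ps" for b using V by auto
  have ct: "cut_vertex G v \<longleftrightarrow> Inr v \<in> set ps" for v using V by auto
  have blocksB: "blocks G = B ` {..<Suc m}"
  proof (intro set_eqI iffI)
    fix b assume "b \<in> blocks G"
    then obtain j where j: "j < n" "ps ! j = Inl b" using bl by (metis in_set_conv_nth n_def)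
    then have "even j" using par[of j] by simp
    then obtain i where "j = 2 * i" by blast
    then show "b \<in> B ` {..<Suc m}" using j m B[of i] by (intro image_eqI[of _ _ i]) auto
  next
    fix b assume "b \<in> B ` {..<Suc m}"
    then obtain i where i: "i < Suc m" "b = B i" by auto
    then have "Inl b \<in> set ps" using B[OF i(1)] nth_mem[of "2 * i" ps] m by (simp add: n_def)
    then show "b \<in> blocks G" using bl by simp
  qed
  have injB: "inj_on B {..<Suc m}"
  proof (rule inj_onI)
    fix i j assume "i \<in> {..<Suc m}" "j \<in> {..<Suc m}" "B i = B j"
    then show "i = j" using B[of i] B[of j] nth_eq[of "2 * i" "2 * j"] m by auto
  qed
  have injc: "inj_on c {..<m}"
  proof (rule inj_onI)
    fix i j assume "i \<in> {..<m}" "j \<in> {..<m}" "c i = c j"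
    then show "i = j" using c[of i] c[of j] nth_eq[of "2 * i + 1" "2 * j + 1"] m by auto
  qed
  have k: "k = Suc m" using card blocksB injB by (simp add: card_image)
  have inc: "c i \<in> verts (B l) \<longleftrightarrow> l = i \<or> l = Suc i" if "i < m" "l < Suc m" for i l
  proof
    have BG: "B l \<in> blocks G" using blocksB that by auto
    have cG: "cut_vertex G (c i)"
      using c[OF that(1)] nth_mem[of "2 * i + 1" ps] m that ct by (simp add: n_def)
    {
      assume "c i \<in> verts (B l)"
      then obtain j where j: "Suc j < n" "{Inl (B l), Inr (c i)} = {ps ! j, ps ! Suc j}"
        using incid BG cG by blast
      then have "{ps ! (2 * l), ps ! (2 * i + 1)} = {ps ! j, ps ! Suc j}"
        using B c that by simp
      then have "ps ! (2 * l) = ps ! j \<and> ps ! (2 * i + 1) = ps ! Suc j \<or>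
          ps ! (2 * l) = ps ! Suc j \<and> ps ! (2 * i + 1) = ps ! j"
        by (simp only: doubleton_eq_iff)
      then have "2 * l = j \<and> 2 * i + 1 = Suc j \<or> 2 * l = Suc j \<and> 2 * i + 1 = j"
        using nth_eq that m j(1) by auto
      then show "l = i \<or> l = Suc i" by presburger
    }
    assume l: "l = i \<or> l = Suc i"
    have "{ps ! (2 * l), ps ! (2 * i + 1)} \<in> {{ps ! i, ps ! Suc i} | i. Suc i < n}"
    proof (cases "l = i")
      case True
      then show ?thesis using that m by auto
    next
      case False
      then have "{ps ! (2 * l), ps ! (2 * i + 1)} = {ps ! (2 * i + 1), ps ! Suc (2 * i + 1)}"
        using l by (auto simp: insert_commute)
      moreover have "Suc (2 * i + 1) < n" using that m by auto
      ultimately show ?thesis by blast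
    qed
    then have "{Inl (B l), Inr (c i)} \<in>
        {{Inl B, Inr v} | B v. B \<in> blocks G \<and> cut_vertex G v \<and> v \<in> verts B}"
      using B c that unfolding E by simp
    then show "c i \<in> verts (B l)" by (auto simp: doubleton_eq_iff)
  qed
  have "filter (\<lambda>x. \<not> isl x) ps = map (\<lambda>i. ps ! (2 * i + 1)) [0..<length ps div 2]"
    by (rule filter_alternating) (use par n_def in auto)
  moreover have "length ps div 2 = m" using m by (simp add: n_def)
  ultimately have "map projr (filter (\<lambda>x. \<not> isl x) ps) = map c [0..<m]"
    using c by simp
  then show ?thesis using that[of B c] blocksB injB injc inc k by auto
qed

text \<open>The vertex \<open>h i j\<close> is number \<open>j\<close> on cycle \<open>i\<close>. Cycle \<open>i + 1\<close> begins, at its position \<open>0\<close>, where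
  cycle \<open>i\<close> is left, at position \<open>D i\<close>. With injectivity of \<open>h i\<close>, the conclusion
  \<open>b = 0\<close> of the last clause also gives \<open>a = D i\<close>.\<close>

definition snake_layout :: "nat \<Rightarrow> nat \<Rightarrow> (nat \<Rightarrow> nat \<Rightarrow> 'a) \<Rightarrow> (nat \<Rightarrow> nat) \<Rightarrow> bool" where
  "snake_layout k r h D \<longleftrightarrow>
     (\<forall>i<k. inj_on (h i) {..<r}) \<and>
     (\<forall>i. Suc i < k \<longrightarrow> D i < r \<and> h (Suc i) 0 = h i (D i)) \<and>
     (\<forall>i i' a b. i < i' \<longrightarrow> i' < k \<longrightarrow> a < r \<longrightarrow> b < r \<longrightarrow> h i a = h i' b \<longrightarrow> i' = Suc i \<and> b = 0)"

text \<open>The first cycle has only one cut vertex, so it can be entered anywhere: its exit position \<open>d0\<close> may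
  be prescribed. On the other cycles the exit position is an entry of the string.\<close>

lemma snake_layout_exists:
  assumes snake: "cyclic_snake k r G" and str: "snake_string G ds"
    and k: "k \<ge> 1" and d0: "d0 < r"
  obtains h D where "snake_layout k r h D"
    "verts G = (\<Union>i<k. h i ` {..<r})" "edges G = (\<Union>i<k. cycle_edges r (h i))"
    "D 0 = d0" "\<And>i. 1 \<le> i \<Longrightarrow> Suc i < k \<Longrightarrow> D i = ds ! (i - 1)"
proof -
  obtain ps cs where ps: "path_order ps (block_cutpoint_graph G)"
    and cs: "cs = map projr (filter (\<lambda>x. \<not> isl x) ps)"
    and ds: "ds = map (\<lambda>i. graph_dist G (cs ! i) (cs ! Suc i)) [0..<length cs - 1]"
    using str by (auto simp: snake_string_def)
  obtain B c where blocksB: "blocks G = B ` {..<k}" and injB: "inj_on B {..<k}"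
    and injc: "inj_on c {..<k - 1}"
    and inc: "\<And>i l. Suc i < k \<Longrightarrow> l < k \<Longrightarrow> c i \<in> verts (B l) \<longleftrightarrow> l = i \<or> l = Suc i"
    and cs': "map projr (filter (\<lambda>x. \<not> isl x) ps) = map c [0..<k - 1]"
    by (rule snake_path[OF snake ps]) blast
  have G: "simple_graph G" using snake by (simp add: cyclic_snake_def)
  have cyc: "cycle_graph r (B i)" if "i < k" for i
    using snake blocksB that by (auto simp: cyclic_snake_def)
  have BG: "subgraph (B i) G" if "i < k" for i
    using blocksB that by (auto simp: blocks_def nonseparable_subgraph_def)
  have shared: "i' = Suc i \<and> v = c i"
    if "i < i'" "i' < k" "v \<in> verts (B i)" "v \<in> verts (B i')" for i i' v
  proof (cases "v \<in> c ` {i..<i'}")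
    case True
    then obtain l where l: "i \<le> l" "l < i'" "v = c l" by auto
    then have "i = l \<or> i = Suc l" "i' = l \<or> i' = Suc l"
      using inc[of l i] inc[of l i'] that by auto
    then show ?thesis using l that by auto
  next
    case False
    have "B i = B i'"
    proof (rule blocks_closed_chain[of i i' B G c v])
      show "inj_on c {i..<i'}" using injc by (rule inj_on_subset) (use that in auto)
      show "B l \<in> blocks G" if "i \<le> l" "l \<le> i'" for l
        using blocksB that \<open>i' < k\<close> by auto
      show "c l \<in> verts (B l) \<and> c l \<in> verts (B (Suc l))" if "i \<le> l" "l < i'" for l
        using inc[of l l] inc[of l "Suc l"] that \<open>i' < k\<close> by auto
    qed (use that False in auto)
    then show ?thesis using injB that by (auto simp: inj_on_def)
  qed
  have vertsG: "verts G = (\<Union>i<k. verts (B i))"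
  proof
    show "verts G \<subseteq> (\<Union>i<k. verts (B i))"
    proof
      fix x assume "x \<in> verts G"
      then obtain C where "C \<in> blocks G" "x \<in> verts C"
        by (rule vertex_in_block[OF G]) blast
      then show "x \<in> (\<Union>i<k. verts (B i))" using blocksB by auto
    qed
    show "(\<Union>i<k. verts (B i)) \<subseteq> verts G" using BG by (auto simp: subgraph_def)
  qed
  have edgesG: "edges G = (\<Union>i<k. edges (B i))"
  proof
    show "edges G \<subseteq> (\<Union>i<k. edges (B i))"
    proof
      fix x assume "x \<in> edges G"
      then obtain C where "C \<in> blocks G" "x \<in> edges C"
        by (rule edge_in_block[OF G]) blast
      then show "x \<in> (\<Union>i<k. edges (B i))" using blocksB by auto
    qed
    show "(\<Union>i<k. edges (B i)) \<subseteq> edges G" using BG by (auto simp: subgraph_def)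
  qed
  have in_B: "x \<in> verts (B i)" if "{x, y} \<in> edges (B i)" "i < k" for x y i
    using BG[OF that(2)] that(1) by (auto simp: subgraph_def simple_graph_def)
  \<comment> \<open>The potential extends the one on block \<open>i + 1\<close> to the snake: all earlier blocks get its value \<open>0\<close> at
    the entry \<open>c i\<close>, all later blocks its value \<open>p\<close> at the exit.\<close>
  have dist: "graph_dist G (c i) (c (Suc i)) = p"
    if i: "Suc (Suc i) < k" and h: "enumerates_cycle r h (B (Suc i))" "h 0 = c i" "h p = c (Suc i)"
      and p: "2 * p \<le> r" "p < r" for i h p
  proof -
    define idx where "idx = inv_into {..<r} h"
    have inj: "inj_on h {..<r}" and VB: "verts (B (Suc i)) = h ` {..<r}"
      and EB: "edges (B (Suc i)) = cycle_edges r h"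
      using h by (auto simp: enumerates_cycle_def)
    have idx: "idx (h j) = j" if "j < r" for j using inj that by (simp add: idx_def)
    define \<phi> where "\<phi> x = (if x \<in> verts (B (Suc i)) then min (idx x) (r - idx x)
      else if \<exists>l\<le>i. x \<in> verts (B l) then 0 else p)" for x
    have \<phi>h: "\<phi> (h j) = min j (r - j)" if "j < r" for j
      using that idx VB by (auto simp: \<phi>_def)
    have \<phi>c: "\<phi> (c i) = 0" "\<phi> (c (Suc i)) = p"
      using \<phi>h[of 0] \<phi>h[of p] p h by auto
    have left: "\<phi> x = 0" if "l \<le> i" "x \<in> verts (B l)" for l x
    proof (cases "x \<in> verts (B (Suc i))")
      case True
      then have "x = c i" using shared[of l "Suc i" x] that i by auto
      then show ?thesis using \<phi>c by simp
    next
      case False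
      then show ?thesis using that by (auto simp: \<phi>_def)
    qed
    have right: "\<phi> x = p" if "Suc i < l" "l < k" "x \<in> verts (B l)" for l x
    proof (cases "x \<in> verts (B (Suc i))")
      case True
      then have "x = c (Suc i)" using shared[of "Suc i" l x] that i by auto
      then show ?thesis using \<phi>c by simp
    next
      case False
      have "x \<notin> verts (B l')" if "l' \<le> i" for l'
        using shared[of l' l x] that \<open>Suc i < l\<close> \<open>l < k\<close> \<open>x \<in> verts (B l)\<close> by auto
      then show ?thesis using False by (auto simp: \<phi>_def)
    qed
    show ?thesis
    proof (rule graph_dist_eqI[where \<phi> = \<phi>])
      show "(c i, c (Suc i)) \<in> adj G ^^ p"
        using cycle_walk[OF h(1) _ p(2), of G] BG[of "Suc i"] i h by (simp add: subgraph_def)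
      show "\<phi> (c (Suc i)) = \<phi> (c i) + p" using \<phi>c by simp
      fix x y assume "{x, y} \<in> edges G"
      then obtain l where l: "l < k" "{x, y} \<in> edges (B l)" using edgesG by auto
      then have xy: "x \<in> verts (B l)" "y \<in> verts (B l)"
        using in_B[of x y] in_B[of y x] by (auto simp: insert_commute)
      consider "l \<le> i" | "l = Suc i" | "Suc i < l" by linarith
      then show "\<phi> y \<le> Suc (\<phi> x)"
      proof cases
        case 1
        then show ?thesis using left xy by simp
      next
        case 2
        then obtain j where j: "j < r" "{x, y} = {h j, h (Suc j mod r)}"
          using l(2) EB by (auto simp: cycle_edges_def)
        have "Suc j mod r < r" using j by simp
        then show ?thesis
          using j(2) \<phi>h[OF j(1)] \<phi>h[of "Suc j mod r"] cycle_index_step[OF j(1)]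
          by (auto simp: doubleton_eq_iff)
      next
        case 3
        then show ?thesis using right xy l(1) by simp
      qed
    qed
  qed
  define D where "D i = (if i = 0 then d0 else graph_dist G (c (i - 1)) (c i))" for i
  have "\<exists>h. enumerates_cycle r h (B i) \<and> (0 < i \<longrightarrow> h 0 = c (i - 1)) \<and>
      (Suc i < k \<longrightarrow> D i < r \<and> h (D i) = c i)" if i: "i < k" for i
  proof (cases "i = 0")
    case True
    show ?thesis
    proof (cases "k = 1")
      case True
      then show ?thesis using cycle_graph_enumerates[OF cyc[OF i]] i by auto
    next
      case False
      then have "c 0 \<in> verts (B 0)" using inc[of 0 0] k by auto
      then obtain h where "enumerates_cycle r h (B 0)" "h d0 = c 0"
        using enumerates_cycle_at[OF cyc[OF i]] d0 \<open>i = 0\<close> by metis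
      then show ?thesis using \<open>i = 0\<close> d0 by (auto simp: D_def)
    qed
  next
    case False
    then obtain i' where i': "i = Suc i'" by (cases i) auto
    have ci: "c i' \<in> verts (B i)" using inc[of i' i] i i' by auto
    show ?thesis
    proof (cases "Suc i < k")
      case True
      then have "c i \<in> verts (B i)" using inc[of i i] i by auto
      then obtain h p where hp: "enumerates_cycle r h (B i)" "h 0 = c i'" "h p = c i"
        "2 * p \<le> r" "p < r"
        using enumerates_cycle_from_to[OF cyc[OF i] ci] by metis
      then have "D i = p" using dist[of i' h p] True i' by (simp add: D_def)
      then show ?thesis using hp i' by auto
    next
      case False
      obtain h where "enumerates_cycle r h (B i)" "h 0 = c i'"
        using enumerates_cycle_from_to[OF cyc[OF i] ci ci] by metis
      then show ?thesis using False i' by auto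
    qed
  qed
  then obtain h where h: "\<And>i. i < k \<Longrightarrow> enumerates_cycle r (h i) (B i)"
    "\<And>i. i < k \<Longrightarrow> 0 < i \<Longrightarrow> h i 0 = c (i - 1)"
    "\<And>i. Suc i < k \<Longrightarrow> D i < r \<and> h i (D i) = c i"
    by (metis Suc_lessD)
  have Vh: "verts (B i) = h i ` {..<r}" and Eh: "edges (B i) = cycle_edges r (h i)"
    and injh: "inj_on (h i) {..<r}" if "i < k" for i
    using h(1)[OF that] by (auto simp: enumerates_cycle_def)
  have "snake_layout k r h D"
    unfolding snake_layout_def
  proof (intro conjI allI impI)
    fix i i' a b assume A: "i < i'" "i' < k" "a < r" "b < r" "h i a = h i' b"
    have "h i a \<in> verts (B i)" using Vh[of i] A(1-3) by auto
    then have "h i' b \<in> verts (B i)" by (simp only: A(5))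
    moreover have "h i' b \<in> verts (B i')" using Vh[OF A(2)] A(4) by auto
    ultimately have S: "i' = Suc i \<and> h i' b = c i" using shared[OF A(1,2)] by blast
    then show "i' = Suc i" by simp
    have "h i' 0 = c (i' - 1)" using h(2)[OF A(2)] A(1) by simp
    also have "c (i' - 1) = h i' b" using S by (metis diff_Suc_1)
    finally have "h i' b = h i' 0" by (rule sym)
    then show "b = 0" using injh[OF A(2)] A by (auto simp: inj_on_def)
  qed (use injh h in auto)
  moreover have "verts G = (\<Union>i<k. h i ` {..<r})" using vertsG Vh by simp
  moreover have "edges G = (\<Union>i<k. cycle_edges r (h i))" using edgesG Eh by simp
  moreover have "D 0 = d0" by (simp add: D_def)
  moreover have "D i = ds ! (i - 1)" if i: "1 \<le> i" "Suc i < k" for i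
  proof -
    obtain i' where i': "i = Suc i'" using i(1) by (cases i) auto
    have "cs = map c [0..<k - 1]" using cs cs' by simp
    moreover have "i' < k - 1 - 1" "i' < k - 1" "Suc i' < k - 1" using i(2) i' by auto
    ultimately show ?thesis using ds by (simp add: D_def i' nth_upt)
  qed
  ultimately show ?thesis by (rule that)
qed

section \<open>Gluing labellings\<close>

lemma edge_label_le: "f u \<le> f v \<Longrightarrow> edge_label f {u, v} = f v - f u"
  by (simp add: edge_label_def)

lemma edge_label_shift:
  assumes "f' u = f u + s" "f' v = f v + s"
  shows "edge_label f' {u, v} = edge_label f {u, v}"
  using assms by (simp add: edge_label_def)

lemma edge_label_complement:
  assumes "f u \<le> m" "f v \<le> m"
  shows "edge_label (\<lambda>x. m - f x) {u, v} = edge_label f {u, v}"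
  using assms by (auto simp: edge_label_def max_def min_def)

text \<open>Injectivity on edges is left out: in all uses \<open>A\<close> has at least as many elements as there are
  edges, so surjectivity onto \<open>A\<close> implies it.\<close>

definition labels_exactly :: "('a \<Rightarrow> nat) \<Rightarrow> 'a set \<Rightarrow> 'a set set \<Rightarrow> nat set \<Rightarrow> nat set \<Rightarrow> bool" where
  "labels_exactly f V E M A \<longleftrightarrow> inj_on f V \<and> f ` V \<subseteq> M \<and> edge_label f ` E = A"

definition edges_within :: "'a set \<Rightarrow> 'a set set \<Rightarrow> bool" where
  "edges_within V E \<longleftrightarrow> (\<forall>e\<in>E. \<exists>u\<in>V. \<exists>v\<in>V. e = {u, v})"

definition straddles :: "('a \<Rightarrow> nat) \<Rightarrow> nat \<Rightarrow> 'a set \<Rightarrow> 'a set set \<Rightarrow> bool" where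
  "straddles g s V E \<longleftrightarrow> (\<forall>e\<in>E. \<exists>u\<in>V. \<exists>v\<in>V. e = {u, v} \<and> g u \<le> s \<and> s < g v)"

lemma labels_exactly_complement:
  assumes "labels_exactly f V E {0..m} A" "edges_within V E"
  shows "labels_exactly (\<lambda>x. m - f x) V E {0..m} A"
proof -
  have le: "f x \<le> m" if "x \<in> V" for x using assms(1) that by (auto simp: labels_exactly_def)
  have "edge_label (\<lambda>x. m - f x) e = edge_label f e" if e: "e \<in> E" for e
  proof -
    obtain u v where "u \<in> V" "v \<in> V" "e = {u, v}" using assms(2) e by (auto simp: edges_within_def)
    then show ?thesis using le edge_label_complement by metis
  qed
  moreover have "inj_on (\<lambda>x. m - f x) V"
    using assms(1) le unfolding labels_exactly_def inj_on_def by (metis diff_diff_cancel)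
  ultimately show ?thesis using assms(1) by (auto simp: labels_exactly_def)
qed

text \<open>The labels of \<open>V\<close>, shifted by \<open>s\<close>, occupy the interval from \<open>s\<close> to \<open>m + s\<close>. The labels of
  \<open>V'\<close> other than that of \<open>a\<close> end up below \<open>s\<close> or above \<open>m + s\<close>, so no collision is possible. An edge
  of \<open>E'\<close> spans the widened gap, which adds \<open>m\<close> to its label.\<close>

lemma glue_around:
  fixes f g :: "'a \<Rightarrow> nat"
  assumes f: "labels_exactly f V E {0..m} A" and E: "edges_within V E"
    and a: "V \<inter> V' = {a}" "f a = 0"
    and g: "inj_on g V'" "g a = s" and E': "straddles g s V' E'"
  obtains f' where "inj_on f' (V \<union> V')" "\<And>x. x \<in> V \<Longrightarrow> s \<le> f' x \<and> f' x \<le> m + s"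
    "\<And>x. x \<in> V' \<Longrightarrow> f' x = (if g x \<le> s then g x else g x + m)"
    "edge_label f' ` (E \<union> E') = A \<union> (+) m ` (edge_label g ` E')"
proof -
  define f' where "f' x = (if x \<in> V then f x + s else if g x \<le> s then g x else g x + m)" for x
  have injf: "inj_on f V" and fle: "\<And>x. x \<in> V \<Longrightarrow> f x \<le> m" and fE: "edge_label f ` E = A"
    using f by (auto simp: labels_exactly_def)
  have aV: "a \<in> V" "a \<in> V'" using a by auto
  have fV: "f' x = f x + s" if "x \<in> V" for x using that by (simp add: f'_def)
  have fV': "f' x = (if g x \<le> s then g x else g x + m)" if "x \<in> V'" for x
  proof (cases "x \<in> V")
    case True
    then have "x = a" using a that by auto
    then show ?thesis using aV a g by (simp add: f'_def)
  next
    case False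
    then show ?thesis by (simp add: f'_def)
  qed
  have out: "f' x < s \<or> f' x > m + s" if "x \<in> V'" "x \<notin> V" for x
  proof -
    have "x \<noteq> a" using that aV by auto
    then have "g x \<noteq> s" using g that aV by (auto simp: inj_on_def)
    then show ?thesis using fV'[OF that(1)] by auto
  qed
  have "inj_on f' (V \<union> V')"
  proof (rule inj_onI)
    fix x y assume xy: "x \<in> V \<union> V'" "y \<in> V \<union> V'" "f' x = f' y"
    have same_side: "w \<in> V" if "z \<in> V" "w \<in> V \<union> V'" "f' z = f' w" for z w
    proof (rule ccontr)
      assume "w \<notin> V"
      then have "f' w < s \<or> f' w > m + s" using out[of w] that(2) by blast
      then show False using fV[OF that(1)] fle[OF that(1)] that(3) by linarith
    qed
    then have "x \<in> V \<longleftrightarrow> y \<in> V" using xy by metis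
    show "x = y"
    proof (cases "x \<in> V")
      case True
      then show ?thesis using xy \<open>x \<in> V \<longleftrightarrow> y \<in> V\<close> fV injf by (auto simp: inj_on_def)
    next
      case False
      then have V': "x \<in> V'" "y \<in> V'" using xy \<open>x \<in> V \<longleftrightarrow> y \<in> V\<close> by auto
      then have "g x = g y" using xy(3) fV' by (auto split: if_splits)
      then show ?thesis using V' g by (auto simp: inj_on_def)
    qed
  qed
  moreover have "edge_label f' e = edge_label f e" if e: "e \<in> E" for e
  proof -
    obtain u v where "u \<in> V" "v \<in> V" "e = {u, v}" using E e by (auto simp: edges_within_def)
    then show ?thesis using fV edge_label_shift by metis
  qed
  then have "edge_label f' ` E = A" using fE by simp
  moreover have "edge_label f' e = m + edge_label g e" if e: "e \<in> E'" for e
  proof -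
    obtain u v where uv: "u \<in> V'" "v \<in> V'" "e = {u, v}" "g u \<le> s" "s < g v"
      using E' e by (auto simp: straddles_def)
    then have "f' u = g u" "f' v = g v + m" using fV' by auto
    then show ?thesis using uv by (simp add: edge_label_le)
  qed
  then have "edge_label f' ` E' = (+) m ` (edge_label g ` E')" by (simp add: image_image)
  ultimately show ?thesis using that[of f'] fV fV' fle by (simp add: image_Un)
qed

section \<open>Labellings of one and of two cycles\<close>

lemma cycle_labels_image:
  assumes "\<And>j. j < r \<Longrightarrow> g (p j) = L j"
  shows "edge_label g ` cycle_edges r p = (\<lambda>j. edge_label L {j, Suc j mod r}) ` {..<r}"
  unfolding cycle_edges_def image_image
proof (rule image_cong[OF refl])
  fix j assume "j \<in> {..<r}"
  then have "j < r" "Suc j mod r < r" by auto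
  then show "edge_label g {p j, p (Suc j mod r)} = edge_label L {j, Suc j mod r}"
    using assms by (simp add: edge_label_def)
qed

lemma cycle_straddles:
  assumes L: "\<And>j. j < r \<Longrightarrow> g (p j) = L j"
    and alt: "\<And>j. j < r \<Longrightarrow> L (Suc j mod r) \<le> s \<longleftrightarrow> \<not> L j \<le> s"
  shows "straddles g s (p ` {..<r}) (cycle_edges r p)"
  unfolding straddles_def
proof
  fix e assume "e \<in> cycle_edges r p"
  then obtain j where j: "j < r" "e = {p j, p (Suc j mod r)}" by (auto simp: cycle_edges_def)
  have j': "Suc j mod r < r" using j by simp
  show "\<exists>u\<in>p ` {..<r}. \<exists>v\<in>p ` {..<r}. e = {u, v} \<and> g u \<le> s \<and> s < g v"
  proof (cases "L j \<le> s")
    case True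
    then have "e = {p j, p (Suc j mod r)} \<and> g (p j) \<le> s \<and> s < g (p (Suc j mod r))"
      using j j' L alt[OF j(1)] by auto
    then show ?thesis using j(1) j' by blast
  next
    case False
    then have "e = {p (Suc j mod r), p j} \<and> g (p (Suc j mod r)) \<le> s \<and> s < g (p j)"
      using j j' L alt[OF j(1)] by auto
    then show ?thesis using j(1) j' by blast
  qed
qed

lemma straddles_Un:
  assumes "straddles g s V E" "straddles g s V' E'"
  shows "straddles g s (V \<union> V') (E \<union> E')"
  unfolding straddles_def
proof
  fix e assume "e \<in> E \<union> E'"
  then obtain u v where "u \<in> V \<union> V'" "v \<in> V \<union> V'" "e = {u, v} \<and> g u \<le> s \<and> s < g v"
    using assms unfolding straddles_def by (metis UnCI UnE)
  then show "\<exists>u\<in>V \<union> V'. \<exists>v\<in>V \<union> V'. e = {u, v} \<and> g u \<le> s \<and> s < g v" by blast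
qed

text \<open>Labels along a cycle, the result of a search without further pattern. The lows are the labels up to \<open>6\<close>, and the label \<open>6\<close>
  itself stands at the attaching vertex, position \<open>0\<close>. The edge labels are \<open>1,\<dots>,13,15\<close>.\<close>

definition inner_labels :: "nat list" where
  "inner_labels = [6, 7, 1, 10, 3, 15, 0, 13, 2, 12, 4, 9, 5, 8]"

text \<open>This cycle surrounds the previous one, whose labels are raised by \<open>8\<close> to make room for the lows
  \<open>0,1,2,3,4,6,7\<close>. It starts at the vertex with label \<open>21 = 13 + 8\<close>, which is position \<open>7\<close> of the inner
  cycle. The edge labels are the missing \<open>14,16,\<dots>,28\<close>, and positions \<open>6\<close> and \<open>7\<close> carry
  \<open>28\<close> and \<open>0\<close>. The threshold is now \<open>14 = 6 + 8\<close>.\<close>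

definition outer_labels :: "nat list" where
  "outer_labels = [21, 1, 26, 4, 25, 2, 28, 0, 27, 3, 22, 6, 24, 7]"

lemma inner_labels_props:
  "\<And>j. j < 14 \<Longrightarrow> inner_labels ! (Suc j mod 14) \<le> 6 \<longleftrightarrow> \<not> inner_labels ! j \<le> 6"
  "(\<lambda>j. edge_label ((!) inner_labels) {j, Suc j mod 14}) ` {..<14} = {1..13} \<union> {15}"
  "inj_on ((!) inner_labels) {..<14}"
  "\<And>j. j < 14 \<Longrightarrow> inner_labels ! j \<le> 13 \<or> inner_labels ! j = 15"
proof -
  have all: "\<forall>j\<in>set [0..<14]. (inner_labels ! (Suc j mod 14) \<le> 6 \<longleftrightarrow> \<not> inner_labels ! j \<le> 6) \<and>
      (inner_labels ! j \<le> 13 \<or> inner_labels ! j = 15)"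
    by code_simp
  show "inner_labels ! (Suc j mod 14) \<le> 6 \<longleftrightarrow> \<not> inner_labels ! j \<le> 6"
    "inner_labels ! j \<le> 13 \<or> inner_labels ! j = 15" if "j < 14" for j
    using all that by auto
  have "(\<lambda>j. edge_label ((!) inner_labels) {j, Suc j mod 14}) ` set [0..<14] = set [1..<14] \<union> {15}"
    unfolding edge_label_def by code_simp
  moreover have "set [0..<14] = {..<14::nat}" "set [1..<14] = {1..13::nat}"
    unfolding set_upt by auto
  ultimately show "(\<lambda>j. edge_label ((!) inner_labels) {j, Suc j mod 14}) ` {..<14} = {1..13} \<union> {15}"
    by (simp only:)
  show "inj_on ((!) inner_labels) {..<14}"
    by (intro inj_on_nth) (auto simp: inner_labels_def)
qed

lemma outer_labels_props:
  "\<And>j. j < 14 \<Longrightarrow> outer_labels ! (Suc j mod 14) \<le> 14 \<longleftrightarrow> \<not> outer_labels ! j \<le> 14"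
  "(\<lambda>j. edge_label ((!) outer_labels) {j, Suc j mod 14}) ` {..<14} = {14} \<union> {16..28}"
  "inj_on ((!) outer_labels) {..<14}"
  "\<And>j. j < 14 \<Longrightarrow> outer_labels ! j \<le> 28"
  "\<And>i j. i < 14 \<Longrightarrow> j < 14 \<Longrightarrow> inner_labels ! i + 8 = outer_labels ! j \<Longrightarrow> i = 7 \<and> j = 0"
proof -
  have all: "\<forall>j\<in>set [0..<14]. (outer_labels ! (Suc j mod 14) \<le> 14 \<longleftrightarrow> \<not> outer_labels ! j \<le> 14) \<and>
      outer_labels ! j \<le> 28 \<and>
      (\<forall>i\<in>set [0..<14]. inner_labels ! i + 8 = outer_labels ! j \<longrightarrow> i = 7 \<and> j = 0)"
    by code_simp
  show "outer_labels ! (Suc j mod 14) \<le> 14 \<longleftrightarrow> \<not> outer_labels ! j \<le> 14"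
    "outer_labels ! j \<le> 28" if "j < 14" for j
    using all that by auto
  show "i = 7 \<and> j = 0" if "i < 14" "j < 14" "inner_labels ! i + 8 = outer_labels ! j" for i j
    using all that by auto
  have "(\<lambda>j. edge_label ((!) outer_labels) {j, Suc j mod 14}) ` set [0..<14] =
      {14} \<union> set [16..<29]"
    unfolding edge_label_def by code_simp
  moreover have "set [0..<14] = {..<14::nat}" "set [16..<29] = {16..28::nat}"
    unfolding set_upt by auto
  ultimately show "(\<lambda>j. edge_label ((!) outer_labels) {j, Suc j mod 14}) ` {..<14} = {14} \<union> {16..28}"
    by (simp only:)
  show "inj_on ((!) outer_labels) {..<14}"
    by (intro inj_on_nth) (auto simp: outer_labels_def)
qed

lemma single_cycle_labelling:
  assumes "inj_on p {..<14}"
  obtains g where "inj_on g (p ` {..<14})" "g (p 0) = 6"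
    "\<And>x. x \<in> p ` {..<14} \<Longrightarrow> g x \<le> 13 \<or> g x = 15"
    "straddles g 6 (p ` {..<14}) (cycle_edges 14 p)"
    "edge_label g ` cycle_edges 14 p = {1..13} \<union> {15}"
proof -
  define g where "g x = inner_labels ! inv_into {..<14} p x" for x
  have g: "g (p j) = inner_labels ! j" if "j < 14" for j
    using assms that by (simp add: g_def)
  have "inj_on g (p ` {..<14})"
    using inner_labels_props(3) g by (auto simp: inj_on_def)
  moreover have "g (p 0) = 6" using g[of 0] by (simp add: inner_labels_def)
  moreover have "g x \<le> 13 \<or> g x = 15" if "x \<in> p ` {..<14}" for x
    using that g inner_labels_props(4) by fastforce
  moreover have "straddles g 6 (p ` {..<14}) (cycle_edges 14 p)"
    by (rule cycle_straddles[where L = "(!) inner_labels"]) (use g inner_labels_props(1) in auto)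
  moreover have "edge_label g ` cycle_edges 14 p = {1..13} \<union> {15}"
    using cycle_labels_image[of 14 g p "(!) inner_labels", OF g] inner_labels_props(2) by simp
  ultimately show ?thesis by (rule that)
qed

text \<open>The raised inner labels and the outer labels have only the value \<open>21\<close> in common, and it belongs to the
  vertex that the cycles share, so the two lists merge into one injective labelling.\<close>

lemma two_cycles_labelling:
  assumes p: "inj_on p {..<14}" and q: "inj_on q {..<14}" and pq: "q 0 = p 7"
    and meet: "\<And>a b. a < 14 \<Longrightarrow> b < 14 \<Longrightarrow> p a = q b \<Longrightarrow> b = 0"
  obtains g where "inj_on g (p ` {..<14} \<union> q ` {..<14})" "g (p 0) = 14"
    "g (q 6) = 28" "g (q 7) = 0" "\<And>x. x \<in> p ` {..<14} \<union> q ` {..<14} \<Longrightarrow> g x \<le> 28"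
    "straddles g 14 (p ` {..<14} \<union> q ` {..<14}) (cycle_edges 14 p \<union> cycle_edges 14 q)"
    "edge_label g ` (cycle_edges 14 p \<union> cycle_edges 14 q) = {1..28}"
proof -
  define g where "g x = (if x \<in> p ` {..<14} then inner_labels ! inv_into {..<14} p x + 8
    else outer_labels ! inv_into {..<14} q x)" for x
  have gp: "g (p j) = inner_labels ! j + 8" if "j < 14" for j
    using p that by (simp add: g_def)
  have gq: "g (q j) = outer_labels ! j" if "j < 14" for j
  proof (cases "q j \<in> p ` {..<14}")
    case True
    then obtain i where "i < 14" "p i = q j" by auto
    then have "j = 0" using meet that by blast
    then show ?thesis using pq gp[of 7] by (simp add: inner_labels_def outer_labels_def)
  next
    case False
    then show ?thesis using q that by (simp add: g_def)
  qed
  have "inj_on g (p ` {..<14} \<union> q ` {..<14})"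
  proof -
    have "inj_on g (p ` {..<14})" using inner_labels_props(3) gp by (auto simp: inj_on_def)
    moreover have "inj_on g (q ` {..<14})" using outer_labels_props(3) gq by (auto simp: inj_on_def)
    moreover have "x = y" if xy: "x \<in> p ` {..<14}" "y \<in> q ` {..<14}" "g x = g y" for x y
    proof -
      obtain i j where ij: "i < 14" "j < 14" "x = p i" "y = q j" using xy by auto
      then have "i = 7" "j = 0" using outer_labels_props(5)[of i j] xy(3) gp gq by auto
      then show ?thesis using ij pq by simp
    qed
    ultimately show ?thesis unfolding inj_on_def by (metis Un_iff)
  qed
  moreover have "g (p 0) = 14" "g (q 6) = 28" "g (q 7) = 0"
    using gp[of 0] gq[of 6] gq[of 7] by (auto simp: inner_labels_def outer_labels_def)
  moreover have "g x \<le> 28" if "x \<in> p ` {..<14} \<union> q ` {..<14}" for x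
    using that gp gq inner_labels_props(4) outer_labels_props(4) by fastforce
  moreover have "straddles g 14 (p ` {..<14} \<union> q ` {..<14}) (cycle_edges 14 p \<union> cycle_edges 14 q)"
  proof (rule straddles_Un)
    show "straddles g 14 (p ` {..<14}) (cycle_edges 14 p)"
      by (rule cycle_straddles[where L = "\<lambda>j. inner_labels ! j + 8"])
        (use gp inner_labels_props(1) in auto)
    show "straddles g 14 (q ` {..<14}) (cycle_edges 14 q)"
      by (rule cycle_straddles[where L = "(!) outer_labels"])
        (use gq outer_labels_props(1) in auto)
  qed
  moreover have "edge_label g ` (cycle_edges 14 p \<union> cycle_edges 14 q) = {1..28}"
  proof -
    have "edge_label g ` cycle_edges 14 p =
        (\<lambda>j. edge_label (\<lambda>j. inner_labels ! j + 8) {j, Suc j mod 14}) ` {..<14}"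
      by (rule cycle_labels_image) (rule gp)
    also have "\<dots> = (\<lambda>j. edge_label ((!) inner_labels) {j, Suc j mod 14}) ` {..<14}"
      by (rule image_cong[OF refl], rule edge_label_shift) auto
    also have "\<dots> = {1..13} \<union> {15}" by (rule inner_labels_props(2))
    finally have "edge_label g ` cycle_edges 14 p = {1..13} \<union> {15}" .
    moreover have "edge_label g ` cycle_edges 14 q = {14} \<union> {16..28}"
      using cycle_labels_image[of 14 g q "(!) outer_labels", OF gq] outer_labels_props(2) by simp
    ultimately show ?thesis by (auto simp: image_Un)
  qed
  ultimately show ?thesis by (rule that)
qed

section \<open>Labelling the snake\<close>

text \<open>The vertex \<open>h 0 0\<close> is included even for \<open>n = 0\<close>, so that the empty snake is a single vertex, to which
  the first pair of cycles is attached like all later ones.\<close>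

definition prefix_verts :: "(nat \<Rightarrow> nat \<Rightarrow> 'a) \<Rightarrow> nat \<Rightarrow> 'a set" where
  "prefix_verts h n = insert (h 0 0) (\<Union>i<n. h i ` {..<14})"

definition prefix_edges :: "(nat \<Rightarrow> nat \<Rightarrow> 'a) \<Rightarrow> nat \<Rightarrow> 'a set set" where
  "prefix_edges h n = (\<Union>i<n. cycle_edges 14 (h i))"

lemma edges_within_prefix: "edges_within (prefix_verts h n) (prefix_edges h n)"
  unfolding edges_within_def prefix_verts_def prefix_edges_def cycle_edges_def
  by (auto intro!: bexI)

lemma card_prefix_edges: "card (prefix_edges h n) \<le> 14 * n"
proof (induction n)
  case (Suc n)
  have "prefix_edges h (Suc n) = cycle_edges 14 (h n) \<union> prefix_edges h n"
    by (auto simp: prefix_edges_def lessThan_Suc)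
  then have "card (prefix_edges h (Suc n)) \<le> card (cycle_edges 14 (h n)) + card (prefix_edges h n)"
    by (simp add: card_Un_le)
  moreover have "card (cycle_edges 14 (h n)) \<le> 14"
    unfolding cycle_edges_def using card_image_le[of "{..<14::nat}"] by fastforce
  ultimately show ?case using Suc by simp
qed (simp add: prefix_edges_def)

lemma attaching_vertex_in_prefix:
  assumes "snake_layout k 14 h D" "n < k"
  shows "h n 0 \<in> prefix_verts h n"
proof (cases n)
  case (Suc n')
  then have "D n' < 14" "h n 0 = h n' (D n')" using assms by (auto simp: snake_layout_def)
  then show ?thesis using Suc by (auto simp: prefix_verts_def)
qed (simp add: prefix_verts_def)

lemma prefix_meets_later:
  assumes lay: "snake_layout k 14 h D" and "n \<le> i" "i < k" "b < 14" "h i b \<in> prefix_verts h n"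
  shows "h i b = h n 0"
proof -
  consider "h i b = h 0 0" | j a where "j < n" "a < 14" "h i b = h j a"
    using assms(5) by (auto simp: prefix_verts_def)
  then show ?thesis
  proof cases
    case 1
    show ?thesis
    proof (cases "n = 0")
      case False
      then have "i = Suc 0 \<and> b = 0"
        using lay 1 assms unfolding snake_layout_def by (metis gr0I le_0_eq zero_less_numeral)
      then show ?thesis using False assms by (auto simp: le_Suc_eq)
    qed (use 1 in simp)
  next
    case 2
    then have "i = Suc j \<and> b = 0"
      using lay assms unfolding snake_layout_def by (metis order_less_le_trans)
    then show ?thesis using 2 assms by (auto simp: le_Suc_eq)
  qed
qed

text \<open>After a pair has been glued, the next attaching vertex has the largest or the smallest label; in
  the first case the complementary labelling is taken.\<close>

lemma even_prefix_labelling: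
  assumes lay: "snake_layout k 14 h D"
    and D: "\<And>i. Suc i < k \<Longrightarrow> (even i \<longrightarrow> D i = 7) \<and> (odd i \<longrightarrow> D i \<in> {6, 7})"
    and "2 * q \<le> k"
  shows "\<exists>f. labels_exactly f (prefix_verts h (2 * q)) (prefix_edges h (2 * q)) {0..28 * q} {1..28 * q} \<and>
     (2 * q < k \<longrightarrow> f (h (2 * q) 0) = 0)"
  using assms(3)
proof (induction q)
  case 0
  then show ?case
    by (intro exI[of _ "\<lambda>_. 0"]) (auto simp: labels_exactly_def prefix_verts_def prefix_edges_def)
next
  case (Suc q)
  let ?n = "2 * q" and ?m = "28 * q"
  let ?p = "h ?n" and ?q = "h (Suc ?n)"
  let ?V = "prefix_verts h ?n" and ?E = "prefix_edges h ?n"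
  let ?V' = "?p ` {..<14} \<union> ?q ` {..<14}" and ?E' = "cycle_edges 14 ?p \<union> cycle_edges 14 ?q"
  have k: "Suc ?n < k" using Suc.prems by simp
  obtain f where f: "labels_exactly f ?V ?E {0..?m} {1..?m}" "f (?p 0) = 0"
    using Suc.IH k by auto
  have inj: "inj_on ?p {..<14}" "inj_on ?q {..<14}" using lay k by (auto simp: snake_layout_def)
  have "?q 0 = ?p 7" using lay k D[of ?n] by (auto simp: snake_layout_def)
  moreover have "b = 0" if "a < 14" "b < 14" "?p a = ?q b" for a b
    using lay that k unfolding snake_layout_def by blast
  ultimately obtain g where g: "inj_on g ?V'" "g (?p 0) = 14" "g (?q 6) = 28" "g (?q 7) = 0"
    "\<And>x. x \<in> ?V' \<Longrightarrow> g x \<le> 28" "straddles g 14 ?V' ?E'" "edge_label g ` ?E' = {1..28}"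
    using two_cycles_labelling[OF inj] by metis
  have meet: "?V \<inter> ?V' = {?p 0}"
  proof
    show "?V \<inter> ?V' \<subseteq> {?p 0}" using prefix_meets_later[OF lay, of ?n] k by fastforce
    show "{?p 0} \<subseteq> ?V \<inter> ?V'" using attaching_vertex_in_prefix[OF lay, of ?n] k by auto
  qed
  obtain f' where f': "inj_on f' (?V \<union> ?V')" "\<And>x. x \<in> ?V \<Longrightarrow> 14 \<le> f' x \<and> f' x \<le> ?m + 14"
    "\<And>x. x \<in> ?V' \<Longrightarrow> f' x = (if g x \<le> 14 then g x else g x + ?m)"
    "edge_label f' ` (?E \<union> ?E') = {1..?m} \<union> (+) ?m ` (edge_label g ` ?E')"
    using glue_around[OF f(1) edges_within_prefix meet f(2) g(1,2,6)] by metis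
  have VE: "prefix_verts h (2 * Suc q) = ?V \<union> ?V'" "prefix_edges h (2 * Suc q) = ?E \<union> ?E'"
    by (auto simp: prefix_verts_def prefix_edges_def lessThan_Suc)
  have "f' x \<le> 28 * Suc q" if "x \<in> ?V \<union> ?V'" for x
    using that f'(2)[of x] f'(3)[of x] g(5)[of x] by (auto split: if_splits)
  then have lab: "labels_exactly f' (prefix_verts h (2 * Suc q)) (prefix_edges h (2 * Suc q))
      {0..28 * Suc q} {1..28 * Suc q}"
    unfolding labels_exactly_def VE f'(4) g(7) using f'(1) by auto
  show ?case
  proof (cases "2 * Suc q < k")
    case True
    then have "h (2 * Suc q) 0 = ?q 6 \<or> h (2 * Suc q) 0 = ?q 7"
      using lay D[of "Suc ?n"] by (auto simp: snake_layout_def)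
    then have "f' (h (2 * Suc q) 0) = 28 * Suc q \<or> f' (h (2 * Suc q) 0) = 0"
      using f'(3) g(3,4) by auto
    then show ?thesis
    proof
      assume "f' (h (2 * Suc q) 0) = 28 * Suc q"
      then show ?thesis
        using labels_exactly_complement[OF lab edges_within_prefix] 
        by (intro exI[of _ "\<lambda>x. 28 * Suc q - f' x"]) simp
    qed (use lab in blast)
  qed (use lab in blast)
qed

text \<open>The last cycle of an odd snake stays alone. Its labelling omits the label \<open>14\<close>, for vertices and
  for edges, and uses \<open>15\<close> instead; after gluing these become \<open>14k\<close> and \<open>14k + 1\<close>.\<close>

lemma odd_prefix_labelling:
  assumes lay: "snake_layout k 14 h D"
    and D: "\<And>i. Suc i < k \<Longrightarrow> (even i \<longrightarrow> D i = 7) \<and> (odd i \<longrightarrow> D i \<in> {6, 7})"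
    and k: "k = Suc (2 * q)"
  shows "\<exists>f. labels_exactly f (prefix_verts h k) (prefix_edges h k)
    ({0..<14 * k} \<union> {14 * k + 1}) ({1..<14 * k} \<union> {14 * k + 1})"
proof -
  let ?n = "2 * q" and ?m = "28 * q"
  let ?p = "h ?n"
  let ?V = "prefix_verts h ?n" and ?E = "prefix_edges h ?n"
  let ?V' = "?p ` {..<14}" and ?E' = "cycle_edges 14 ?p"
  obtain f where f: "labels_exactly f ?V ?E {0..?m} {1..?m}" "f (?p 0) = 0"
    using even_prefix_labelling[OF lay D, of q] k by auto
  have "inj_on ?p {..<14}" using lay k by (auto simp: snake_layout_def)
  then obtain g where g: "inj_on g ?V'" "g (?p 0) = 6"
    "\<And>x. x \<in> ?V' \<Longrightarrow> g x \<le> 13 \<or> g x = 15" "straddles g 6 ?V' ?E'"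
    "edge_label g ` ?E' = {1..13} \<union> {15}"
    using single_cycle_labelling by metis
  have meet: "?V \<inter> ?V' = {?p 0}"
  proof
    show "?V \<inter> ?V' \<subseteq> {?p 0}" using prefix_meets_later[OF lay, of ?n] k by fastforce
    show "{?p 0} \<subseteq> ?V \<inter> ?V'" using attaching_vertex_in_prefix[OF lay, of ?n] k by auto
  qed
  obtain f' where f': "inj_on f' (?V \<union> ?V')" "\<And>x. x \<in> ?V \<Longrightarrow> 6 \<le> f' x \<and> f' x \<le> ?m + 6"
    "\<And>x. x \<in> ?V' \<Longrightarrow> f' x = (if g x \<le> 6 then g x else g x + ?m)"
    "edge_label f' ` (?E \<union> ?E') = {1..?m} \<union> (+) ?m ` (edge_label g ` ?E')"
    using glue_around[OF f(1) edges_within_prefix meet f(2) g(1,2,4)] by metis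
  have VE: "prefix_verts h k = ?V \<union> ?V'" "prefix_edges h k = ?E \<union> ?E'"
    using k by (auto simp: prefix_verts_def prefix_edges_def lessThan_Suc)
  have "f' x \<in> {0..<14 * k} \<union> {14 * k + 1}" if "x \<in> ?V \<union> ?V'" for x
    using that f'(2)[of x] f'(3)[of x] g(3)[of x] k by (auto split: if_splits)
  moreover have "{1..?m} \<union> (+) ?m ` ({1..13} \<union> {15}) = {1..<14 * k} \<union> {14 * k + 1}"
    using k by auto
  ultimately have "labels_exactly f' (prefix_verts h k) (prefix_edges h k)
      ({0..<14 * k} \<union> {14 * k + 1}) ({1..<14 * k} \<union> {14 * k + 1})"
    unfolding labels_exactly_def VE f'(4) g(5) using f'(1) by blast
  then show ?thesis by blast
qed

theorem theorem3p3:
  fixes G :: "'a ugraph" and k :: nat and ds :: "nat list"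
  assumes "k \<ge> 1"
    and "cyclic_snake k 14 G"
    and "snake_string G ds"
    and "\<forall>i. 1 \<le> i \<and> i \<le> k - 2 \<longrightarrow>
           (odd i \<longrightarrow> ds ! (i - 1) \<in> {6, 7}) \<and> (even i \<longrightarrow> ds ! (i - 1) = 7)"
  shows "(even k \<longrightarrow> graceful G) \<and> (odd k \<longrightarrow> near_graceful_omitting G)"
proof -
  \<comment> \<open>The free exit of the first cycle is put at distance \<open>7\<close>, as on every other cycle of even index.\<close>
  obtain h D where lay: "snake_layout k 14 h D"
    and V: "verts G = (\<Union>i<k. h i ` {..<14})" and E: "edges G = (\<Union>i<k. cycle_edges 14 (h i))"
    and D0: "D 0 = 7" and D1: "\<And>i. 1 \<le> i \<Longrightarrow> Suc i < k \<Longrightarrow> D i = ds ! (i - 1)"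
    by (rule snake_layout_exists[OF assms(2,3,1), of 7]) auto
  have D: "(even i \<longrightarrow> D i = 7) \<and> (odd i \<longrightarrow> D i \<in> {6, 7})" if "Suc i < k" for i
  proof (cases "i = 0")
    case False
    then have "1 \<le> i \<and> i \<le> k - 2" using that by auto
    then show ?thesis using assms(4) D1[of i] that by auto
  qed (simp add: D0)
  have "h 0 0 \<in> verts G" using V assms(1) by force
  then have VG: "prefix_verts h k = verts G" and EG: "prefix_edges h k = edges G"
    using V E by (auto simp: prefix_verts_def prefix_edges_def)
  have fin: "finite (edges G)" unfolding E by (auto simp: cycle_edges_def)
  \<comment> \<open>There are at most \<open>14k\<close> edges, and they carry \<open>14k\<close> different labels. This gives both the number of
    edges and the injectivity of the edge labelling.\<close>
  have bij: "bij_betw (edge_label f) (edges G) A \<and> card (edges G) = 14 * k"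
    if "labels_exactly f (verts G) (edges G) M A" "card A = 14 * k" for f M A
  proof -
    have A: "edge_label f ` edges G = A" using that by (simp add: labels_exactly_def)
    have "card A \<le> card (edges G)" using card_image_le[OF fin, of "edge_label f"] A by simp
    moreover have "card (edges G) \<le> 14 * k" using card_prefix_edges[of h k] EG by simp
    ultimately have "card (edges G) = 14 * k" using that(2) by simp
    then show ?thesis
      using A that(2) fin by (auto simp: bij_betw_def intro: eq_card_imp_inj_on)
  qed
  show ?thesis
  proof (intro conjI impI)
    assume "even k"
    then obtain q where q: "k = 2 * q" by blast
    then obtain f where f: "labels_exactly f (verts G) (edges G) {0..14 * k} {1..14 * k}"
      using even_prefix_labelling[OF lay D, of q] VG EG by auto
    then show "graceful G"
      using bij[OF f] unfolding graceful_def graceful_labelling_def labels_exactly_def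
      by (intro exI[of _ f]) simp
  next
    assume "odd k"
    then obtain q where q: "k = Suc (2 * q)" by (auto elim: oddE)
    then obtain f where f: "labels_exactly f (verts G) (edges G)
        ({0..<14 * k} \<union> {14 * k + 1}) ({1..<14 * k} \<union> {14 * k + 1})"
      using odd_prefix_labelling[OF lay D q] VG EG by auto
    have "card ({1..<14 * k} \<union> {14 * k + 1}) = 14 * k"
      using assms(1) by (subst card_Un_disjoint) auto
    note b = bij[OF f this]
    have "f ` verts G \<subseteq> {0..14 * k + 1}" using f by (fastforce simp: labels_exactly_def)
    then show "near_graceful_omitting G"
      using b f
      unfolding near_graceful_omitting_def near_graceful_labelling_def labels_exactly_def
      by (intro exI[of _ f]) (simp add: Let_def)
  qed
qed

end
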